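(* The nonsymmetric operad $\mathrm{ncHyperCom}:=(\mathcal S\,\mathrm{ncGrav})^!$ is generated by operations $\nu_k\in\mathrm{ncHyperCom}(k)$ of degree $2k-4$, for $k\ge2$, with defining relations $$\sum_{j=2}^{i}\nu_{n-j+1}\circ_{i-j+1}\nu_j=\sum_{k=2}^{n-i+1}\nu_{n-k+1}\circ_i\nu_k,\qquad n\ge 3,\ \ 2\le i\le n-1 .$$
   Context: All operads are nonsymmetric (ns), in graded vector spaces over a field $\Bbbk$, with Koszul signs. $\mathrm{ncGrav}$ is the ns operad with generators $\lambda_k$ of arity $k$ and degree $1$, $k\ge2$, and quadratic relations $$\sum_{j=r}^{r+k-2}\lambda_{n-1}\circ_j\lambda_2=\lambda_{n-k+1}\circ_r\lambda_k\quad (n\ge4,\ 3\le k<n,\ 1\le r\le n-k+1),\qquad \sum_{j=1}^{n-1}\lambda_{n-1}\circ_j\lambda_2=0\quad(n\ge3).$$ Let $s$ be an element of degree $1$. $\mathcal S=\mathrm{End}_{\Bbbk s}$ is the endomorphism operad of the one-dimensional space $\Bbbk s$, and the operadic suspension of $\mathcal P$ is the Hadamard (arity-wise) tensor product $\mathcal S\mathcal P=\mathcal S\otimes_{\mathrm H}\mathcal P$; $\mathcal S^{-1}=\mathrm{End}_{\Bbbk s^{-1}}$. For a quadratic ns operad $\mathcal P=\mathcal T(E)/(R)$ with $E$ finite-dimensional in each arity, the Koszul dual operad $\mathcal P^!$ is the quadratic operad $\mathcal T(s^{-1}\mathcal S^{-1}\otimes_{\mathrm H}E^* )/(R^\perp)$,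 equivalently the linear dual of the appropriate operadic suspension of the Koszul dual cooperad of $\mathcal P$. The Koszul dual of $\mathcal S\,\mathrm{ncGrav}$ is taken with respect to the presentation of $\mathrm{ncGrav}$ by the generators $\lambda_k$ ($k\ge2$, arity $k$, degree $1$) and the quadratic relations $\sum_{j=r}^{r+k-2}\lambda_{n-1}\circ_j\lambda_2=\lambda_{n-k+1}\circ_r\lambda_k$ ($n\ge4$, $3\le k<n$, $1\le r\le n-k+1$) and $\sum_{j=1}^{n-1}\lambda_{n-1}\circ_j\lambda_2=0$ ($n\ge3$). *)

theory Defs
  imports Main "HOL-Library.Poly_Mapping"
begin

section \<open>Nonsymmetric operads in graded vector spaces\<close>

definition koszul :: "int \<Rightarrow> int \<Rightarrow> 'k::field" where
  "koszul p q = (if odd p \<and> odd q then - 1 else 1)"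

text \<open>
  \<open>homog P n d\<close> is the component of arity \<open>n\<close> and degree \<open>d\<close>; the
  homogeneous components are subspaces of one ambient space, so they share their zero and
  their linear operations.  \<open>pcomp P x i y\<close> is the partial composition of \<open>y\<close> into
  the \<open>i\<close>-th input of \<open>x\<close>, inputs being numbered from 1.  In all constructions below it
  is bilinear on the whole ambient space and zero on components where \<open>i\<close> is out of range.
\<close>

record ('k, 'a) operad =
  homog :: "nat \<Rightarrow> int \<Rightarrow> 'a set"
  zer :: 'a
  add :: "'a \<Rightarrow> 'a \<Rightarrow> 'a"
  smul :: "'k \<Rightarrow> 'a \<Rightarrow> 'a"
  pcomp :: "'a \<Rightarrow> nat \<Rightarrow> 'a \<Rightarrow> 'a"
  ident :: 'a

definition graded_space :: "('k::field, 'a) operad \<Rightarrow> bool" where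
  "graded_space P \<longleftrightarrow> (\<forall>n d.
     zer P \<in> homog P n d \<and>
     (\<forall>x\<in>homog P n d. \<forall>y\<in>homog P n d. \<forall>a b.
        add P x y \<in> homog P n d \<and> smul P a x \<in> homog P n d \<and>
        add P x y = add P y x \<and> add P (zer P) x = x \<and>
        add P x (smul P (- 1) x) = zer P \<and>
        smul P 1 x = x \<and> smul P a (smul P b x) = smul P (a * b) x \<and>
        smul P (a + b) x = add P (smul P a x) (smul P b x) \<and>
        smul P a (add P x y) = add P (smul P a x) (smul P a y) \<and>
        (\<forall>z\<in>homog P n d. add P (add P x y) z = add P x (add P y z))))"

definition bilinear_comp :: "('k::field, 'a) operad \<Rightarrow> bool" where
  "bilinear_comp P \<longleftrightarrow> (\<forall>m d n e i. 1 \<le> i \<and> i \<le> m \<longrightarrow>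
     (\<forall>x\<in>homog P m d. \<forall>y\<in>homog P n e.
        pcomp P x i y \<in> homog P (m + n - 1) (d + e) \<and>
        (\<forall>c. pcomp P (smul P c x) i y = smul P c (pcomp P x i y) \<and>
             pcomp P x i (smul P c y) = smul P c (pcomp P x i y)) \<and>
        (\<forall>x'\<in>homog P m d. pcomp P (add P x x') i y = add P (pcomp P x i y) (pcomp P x' i y)) \<and>
        (\<forall>y'\<in>homog P n e. pcomp P x i (add P y y') = add P (pcomp P x i y) (pcomp P x i y'))))"

definition unital_comp :: "('k::field, 'a) operad \<Rightarrow> bool" where
  "unital_comp P \<longleftrightarrow> ident P \<in> homog P 1 0 \<and>
     (\<forall>n d. \<forall>x\<in>homog P n d. pcomp P (ident P) 1 x = x \<and>
        (\<forall>i. 1 \<le> i \<and> i \<le> n \<longrightarrow> pcomp P x i (ident P) = x))"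

definition associative_comp :: "('k::field, 'a) operad \<Rightarrow> bool" where
  "associative_comp P \<longleftrightarrow> (\<forall>l a m b n c.
     \<forall>x\<in>homog P l a. \<forall>y\<in>homog P m b. \<forall>z\<in>homog P n c.
       (\<forall>i j. 1 \<le> i \<and> i \<le> l \<and> 1 \<le> j \<and> j \<le> m \<longrightarrow>
          pcomp P (pcomp P x i y) (i - 1 + j) z = pcomp P x i (pcomp P y j z)) \<and>
       (\<forall>i k. 1 \<le> i \<and> i < k \<and> k \<le> l \<longrightarrow>
          pcomp P (pcomp P x i y) (k - 1 + m) z
            = smul P (koszul b c) (pcomp P (pcomp P x k z) i y)))"

definition ns_operad :: "('k::field, 'a) operad \<Rightarrow> bool" where
  "ns_operad P \<longleftrightarrow>
     graded_space P \<and> bilinear_comp P \<and> unital_comp P \<and> associative_comp P"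

definition operad_iso ::
  "('a \<Rightarrow> 'b) \<Rightarrow> ('k::field, 'a) operad \<Rightarrow> ('k, 'b) operad \<Rightarrow> bool" where
  "operad_iso f P Q \<longleftrightarrow>
     (\<forall>n d. bij_betw f (homog P n d) (homog Q n d)) \<and>
     (\<forall>n d. \<forall>x\<in>homog P n d. \<forall>y\<in>homog P n d. f (add P x y) = add Q (f x) (f y)) \<and>
     (\<forall>n d c. \<forall>x\<in>homog P n d. f (smul P c x) = smul Q c (f x)) \<and>
     (\<forall>m d n e i. 1 \<le> i \<and> i \<le> m \<longrightarrow>
        (\<forall>x\<in>homog P m d. \<forall>y\<in>homog P n e. f (pcomp P x i y) = pcomp Q (f x) i (f y))) \<and>
     f (ident P) = ident Q"


section \<open>Ideals and quotients\<close>

inductive_set operad_ideal :: "('k::field, 'a) operad \<Rightarrow> 'a set \<Rightarrow> 'a set"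
  for P :: "('k, 'a) operad" and R :: "'a set" where
  rel: "r \<in> R \<Longrightarrow> r \<in> operad_ideal P R"
| zero: "zer P \<in> operad_ideal P R"
| add: "x \<in> operad_ideal P R \<Longrightarrow> y \<in> operad_ideal P R \<Longrightarrow> add P x y \<in> operad_ideal P R"
| smul: "x \<in> operad_ideal P R \<Longrightarrow> smul P c x \<in> operad_ideal P R"
| comp_left: "x \<in> operad_ideal P R \<Longrightarrow> x \<in> homog P m d \<Longrightarrow> y \<in> homog P n e \<Longrightarrow>
    1 \<le> i \<Longrightarrow> i \<le> m \<Longrightarrow> pcomp P x i y \<in> operad_ideal P R"
| comp_right: "y \<in> operad_ideal P R \<Longrightarrow> y \<in> homog P n e \<Longrightarrow> x \<in> homog P m d \<Longrightarrow>
    1 \<le> i \<Longrightarrow> i \<le> m \<Longrightarrow> pcomp P x i y \<in> operad_ideal P R"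

definition coset :: "('k::field, 'a) operad \<Rightarrow> 'a set \<Rightarrow> 'a \<Rightarrow> 'a set" where
  "coset P I x = (\<lambda>z. add P x z) ` I"

definition quot :: "('k::field, 'a) operad \<Rightarrow> 'a set \<Rightarrow> ('k, 'a set) operad" where
  "quot P I = \<lparr>
     homog = (\<lambda>n d. coset P I ` homog P n d),
     zer = coset P I (zer P),
     add = (\<lambda>X Y. \<Union>x\<in>X. \<Union>y\<in>Y. coset P I (add P x y)),
     smul = (\<lambda>c X. \<Union>x\<in>X. coset P I (smul P c x)),
     pcomp = (\<lambda>X i Y. \<Union>x\<in>X. \<Union>y\<in>Y. coset P I (pcomp P x i y)),
     ident = coset P I (ident P)\<rparr>"


section \<open>Linear and bilinear extension\<close>

definition scale :: "'k::field \<Rightarrow> ('b \<Rightarrow>\<^sub>0 'k) \<Rightarrow> ('b \<Rightarrow>\<^sub>0 'k)" where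
  "scale c x = Poly_Mapping.map (\<lambda>a. c * a) x"

definition bilin :: "('b \<Rightarrow> 'b \<Rightarrow> ('c \<Rightarrow>\<^sub>0 'k)) \<Rightarrow> ('b \<Rightarrow>\<^sub>0 'k) \<Rightarrow> ('b \<Rightarrow>\<^sub>0 'k) \<Rightarrow> ('c \<Rightarrow>\<^sub>0 'k::field)" where
  "bilin f x y = (\<Sum>s\<in>Poly_Mapping.keys x. \<Sum>t\<in>Poly_Mapping.keys y.
     scale (Poly_Mapping.lookup x s * Poly_Mapping.lookup y t) (f s t))"


section \<open>The free operad\<close>

text \<open>
  A graded collection is given by a homogeneous basis \<open>gset E\<close>, with the arity and the
  degree of each basis element.
\<close>

record 'g collection =
  gset :: "'g set"
  gar :: "'g \<Rightarrow> nat"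
  gdeg :: "'g \<Rightarrow> int"

datatype 'g ptree = Leaf | Node 'g "'g ptree list"

fun wf_tree :: "'g collection \<Rightarrow> 'g ptree \<Rightarrow> bool" where
  "wf_tree E Leaf \<longleftrightarrow> True"
| "wf_tree E (Node b ts) \<longleftrightarrow> b \<in> gset E \<and> length ts = gar E b \<and> (\<forall>t\<in>set ts. wf_tree E t)"

fun leaves :: "'g ptree \<Rightarrow> nat" where
  "leaves Leaf = 1"
| "leaves (Node b ts) = (\<Sum>t\<leftarrow>ts. leaves t)"

fun weight :: "'g ptree \<Rightarrow> nat" where
  "weight Leaf = 0"
| "weight (Node b ts) = 1 + (\<Sum>t\<leftarrow>ts. weight t)"

fun tdeg :: "'g collection \<Rightarrow> 'g ptree \<Rightarrow> int" where
  "tdeg E Leaf = 0"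
| "tdeg E (Node b ts) = gdeg E b + (\<Sum>t\<leftarrow>ts. tdeg E t)"

fun graft :: "'g ptree \<Rightarrow> nat \<Rightarrow> 'g ptree \<Rightarrow> 'g ptree"
  and graft_list :: "'g ptree list \<Rightarrow> nat \<Rightarrow> 'g ptree \<Rightarrow> 'g ptree list" where
  "graft Leaf i u = u"
| "graft (Node b ts) i u = Node b (graft_list ts i u)"
| "graft_list [] i u = []"
| "graft_list (t # ts) i u =
     (if i \<le> leaves t then graft t i u # ts else t # graft_list ts (i - leaves t) u)"

text \<open>
  A tree stands for the tensor product of its vertices in preorder.  Grafting \<open>u\<close> onto the
  \<open>i\<close>-th leaf of \<open>t\<close> therefore moves \<open>u\<close> past the vertices of \<open>t\<close> that come after this
  leaf in preorder; \<open>deg_after E t i\<close> is the total degree of these vertices.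
\<close>

fun deg_after :: "'g collection \<Rightarrow> 'g ptree \<Rightarrow> nat \<Rightarrow> int"
  and deg_after_list :: "'g collection \<Rightarrow> 'g ptree list \<Rightarrow> nat \<Rightarrow> int" where
  "deg_after E Leaf i = 0"
| "deg_after E (Node b ts) i = deg_after_list E ts i"
| "deg_after_list E [] i = 0"
| "deg_after_list E (t # ts) i =
     (if i \<le> leaves t then deg_after E t i + (\<Sum>u\<leftarrow>ts. tdeg E u)
      else deg_after_list E ts (i - leaves t))"

definition free_operad :: "'g collection \<Rightarrow> ('k::field, 'g ptree \<Rightarrow>\<^sub>0 'k) operad" where
  "free_operad E = \<lparr>
     homog = (\<lambda>n d. {x. \<forall>t\<in>Poly_Mapping.keys x. wf_tree E t \<and> leaves t = n \<and> tdeg E t = d}),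
     zer = 0,
     add = (+),
     smul = scale,
     pcomp = (\<lambda>x i y. bilin (\<lambda>t u. if 1 \<le> i \<and> i \<le> leaves t
        then Poly_Mapping.single (graft t i u) (koszul (deg_after E t i) (tdeg E u)) else 0) x y),
     ident = Poly_Mapping.single Leaf 1\<rparr>"

definition corolla :: "'g collection \<Rightarrow> 'g \<Rightarrow> 'g ptree" where
  "corolla E b = Node b (replicate (gar E b) Leaf)"

definition gen :: "'g collection \<Rightarrow> 'g \<Rightarrow> ('g ptree \<Rightarrow>\<^sub>0 'k::field)" where
  "gen E b = Poly_Mapping.single (corolla E b) 1"

definition gen_comp :: "'g collection \<Rightarrow> 'g \<Rightarrow> nat \<Rightarrow> 'g \<Rightarrow> ('g ptree \<Rightarrow>\<^sub>0 'k::field)" where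
  "gen_comp E b i c = pcomp (free_operad E) (gen E b) i (gen E c)"

definition presented_operad ::
  "'g collection \<Rightarrow> ('g ptree \<Rightarrow>\<^sub>0 'k) set \<Rightarrow> ('k::field, ('g ptree \<Rightarrow>\<^sub>0 'k) set) operad" where
  "presented_operad E R = quot (free_operad E) (operad_ideal (free_operad E) R)"

definition gen_class ::
  "'g collection \<Rightarrow> ('g ptree \<Rightarrow>\<^sub>0 'k) set \<Rightarrow> 'g \<Rightarrow> ('g ptree \<Rightarrow>\<^sub>0 'k::field) set" where
  "gen_class E R b = coset (free_operad E) (operad_ideal (free_operad E) R) (gen E b)"

definition is_presentation ::
  "('k::field, 'a) operad \<Rightarrow> 'g collection \<Rightarrow> ('g \<Rightarrow> 'a) \<Rightarrow> ('g ptree \<Rightarrow>\<^sub>0 'k) set \<Rightarrow> bool" where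
  "is_presentation P E g R \<longleftrightarrow> ns_operad P \<and>
     (\<forall>b\<in>gset E. g b \<in> homog P (gar E b) (gdeg E b)) \<and>
     (\<exists>f. operad_iso f (presented_operad E R) P \<and> (\<forall>b\<in>gset E. f (gen_class E R b) = g b))"


section \<open>Hadamard product and operadic suspension\<close>

text \<open>
  The Hadamard product is the quotient of the vector space freely spanned by formal tensors
  \<open>(n, a, p, b, q)\<close>, with \<open>p\<close> in \<open>P(n)\<close> of degree \<open>a\<close> and \<open>q\<close> in \<open>Q(n)\<close> of degree \<open>b\<close>,
  by the bilinearity relations.
\<close>

type_synonym ('a, 'b) ftensor = "nat \<times> int \<times> 'a \<times> int \<times> 'b"

definition tensor_free ::
  "('k::field, 'a) operad \<Rightarrow> ('k, 'b) operad \<Rightarrow> ('k, ('a, 'b) ftensor \<Rightarrow>\<^sub>0 'k) operad" where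
  "tensor_free P Q = \<lparr>
     homog = (\<lambda>n d. {x. \<forall>(n', a, p, b, q)\<in>Poly_Mapping.keys x.
        n' = n \<and> a + b = d \<and> p \<in> homog P n a \<and> q \<in> homog Q n b}),
     zer = 0,
     add = (+),
     smul = scale,
     pcomp = (\<lambda>x i y. bilin (\<lambda>(m, a, p, b, q) (n, a', p', b', q'). if 1 \<le> i \<and> i \<le> m
        then Poly_Mapping.single (m + n - 1, a + a', pcomp P p i p', b + b', pcomp Q q i q')
               (koszul b a') else 0) x y),
     ident = Poly_Mapping.single (1, 0, ident P, 0, ident Q) 1\<rparr>"

inductive_set tensor_rels ::
  "('k::field, 'a) operad \<Rightarrow> ('k, 'b) operad \<Rightarrow> (('a, 'b) ftensor \<Rightarrow>\<^sub>0 'k) set"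
  for P :: "('k, 'a) operad" and Q :: "('k, 'b) operad" where
  zero: "0 \<in> tensor_rels P Q"
| add: "x \<in> tensor_rels P Q \<Longrightarrow> y \<in> tensor_rels P Q \<Longrightarrow> x + y \<in> tensor_rels P Q"
| smul: "x \<in> tensor_rels P Q \<Longrightarrow> scale c x \<in> tensor_rels P Q"
| add_left: "p \<in> homog P n a \<Longrightarrow> p' \<in> homog P n a \<Longrightarrow> q \<in> homog Q n b \<Longrightarrow>
    Poly_Mapping.single (n, a, add P p p', b, q) 1
      - Poly_Mapping.single (n, a, p, b, q) 1 - Poly_Mapping.single (n, a, p', b, q) 1
    \<in> tensor_rels P Q"
| add_right: "p \<in> homog P n a \<Longrightarrow> q \<in> homog Q n b \<Longrightarrow> q' \<in> homog Q n b \<Longrightarrow>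
    Poly_Mapping.single (n, a, p, b, add Q q q') 1
      - Poly_Mapping.single (n, a, p, b, q) 1 - Poly_Mapping.single (n, a, p, b, q') 1
    \<in> tensor_rels P Q"
| smul_left: "p \<in> homog P n a \<Longrightarrow> q \<in> homog Q n b \<Longrightarrow>
    Poly_Mapping.single (n, a, smul P c p, b, q) 1 - Poly_Mapping.single (n, a, p, b, q) c
    \<in> tensor_rels P Q"
| smul_right: "p \<in> homog P n a \<Longrightarrow> q \<in> homog Q n b \<Longrightarrow>
    Poly_Mapping.single (n, a, p, b, smul Q c q) 1 - Poly_Mapping.single (n, a, p, b, q) c
    \<in> tensor_rels P Q"

definition hadamard ::
  "('k::field, 'a) operad \<Rightarrow> ('k, 'b) operad \<Rightarrow> ('k, (('a, 'b) ftensor \<Rightarrow>\<^sub>0 'k) set) operad" where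
  "hadamard P Q = quot (tensor_free P Q) (tensor_rels P Q)"

definition tensor ::
  "('k::field, 'a) operad \<Rightarrow> ('k, 'b) operad \<Rightarrow> ('a, 'b) ftensor
     \<Rightarrow> (('a, 'b) ftensor \<Rightarrow>\<^sub>0 'k) set" where
  "tensor P Q t = coset (tensor_free P Q) (tensor_rels P Q) (Poly_Mapping.single t 1)"

text \<open>
  The endomorphism operad of a line spanned by an element \<open>v\<close> of degree \<open>e\<close>: its arity
  \<open>n\<close> part is spanned by the map sending the \<open>n\<close>-fold tensor power of \<open>v\<close> to \<open>v\<close>, which has
  degree \<open>e - n * e\<close>.  In the composition at the \<open>i\<close>-th input the second map passes
  \<open>i - 1\<close> copies of \<open>v\<close>.
\<close>

definition end_deg :: "int \<Rightarrow> nat \<Rightarrow> int" where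
  "end_deg e n = e - int n * e"

definition end_sign :: "int \<Rightarrow> nat \<Rightarrow> nat \<Rightarrow> 'k::field" where
  "end_sign e i n = koszul (int (i - 1) * e) (end_deg e n)"

definition end_line :: "int \<Rightarrow> ('k::field, nat \<Rightarrow>\<^sub>0 'k) operad" where
  "end_line e = \<lparr>
     homog = (\<lambda>n d. {x. \<forall>m\<in>Poly_Mapping.keys x. m = n \<and> d = end_deg e n}),
     zer = 0,
     add = (+),
     smul = scale,
     pcomp = (\<lambda>x i y. bilin (\<lambda>m n. if 1 \<le> i \<and> i \<le> m
        then Poly_Mapping.single (m + n - 1) (end_sign e i n) else 0) x y),
     ident = Poly_Mapping.single 1 1\<rparr>"

definition suspension ::
  "('k::field, 'a) operad \<Rightarrow> ('k, ((nat \<Rightarrow>\<^sub>0 'k, 'a) ftensor \<Rightarrow>\<^sub>0 'k) set) operad" where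
  "suspension P = hadamard (end_line 1) P"

definition susp_collection :: "'g collection \<Rightarrow> 'g collection" where
  "susp_collection E = E\<lparr>gdeg := \<lambda>b. end_deg 1 (gar E b) + gdeg E b\<rparr>"

definition susp_gen ::
  "('k::field, 'a) operad \<Rightarrow> 'g collection \<Rightarrow> ('g \<Rightarrow> 'a) \<Rightarrow> 'g
     \<Rightarrow> ((nat \<Rightarrow>\<^sub>0 'k, 'a) ftensor \<Rightarrow>\<^sub>0 'k) set" where
  "susp_gen P E g b = tensor (end_line 1) P
     (gar E b, end_deg 1 (gar E b), Poly_Mapping.single (gar E b) 1, gdeg E b, g b)"


section \<open>Quadratic relations and the Koszul dual operad\<close>

text \<open>
  Evaluation of tree monomials at elements \<open>g b\<close> of an operad.  Composing the subtrees from left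
  to right agrees with the preorder convention, so no signs occur.
\<close>

fun eval_tree :: "('k::field, 'a) operad \<Rightarrow> ('g \<Rightarrow> 'a) \<Rightarrow> 'g ptree \<Rightarrow> 'a"
  and eval_list :: "('k, 'a) operad \<Rightarrow> ('g \<Rightarrow> 'a) \<Rightarrow> 'a \<Rightarrow> nat \<Rightarrow> 'g ptree list \<Rightarrow> 'a" where
  "eval_tree P g Leaf = ident P"
| "eval_tree P g (Node b ts) = eval_list P g (g b) 1 ts"
| "eval_list P g x i [] = x"
| "eval_list P g x i (t # ts) = eval_list P g (pcomp P x i (eval_tree P g t)) (i + leaves t) ts"

definition eval :: "('k::field, 'a) operad \<Rightarrow> ('g \<Rightarrow> 'a) \<Rightarrow> ('g ptree \<Rightarrow>\<^sub>0 'k) \<Rightarrow> 'a" where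
  "eval P g x = Finite_Set.fold
     (\<lambda>t. add P (smul P (Poly_Mapping.lookup x t) (eval_tree P g t))) (zer P) (Poly_Mapping.keys x)"

definition quadratic :: "'g collection \<Rightarrow> ('g ptree \<Rightarrow>\<^sub>0 'k::field) set" where
  "quadratic E = {x. (\<exists>n d. x \<in> homog (free_operad E) n d) \<and>
     (\<forall>t\<in>Poly_Mapping.keys x. weight t = 2)}"

text \<open>The quadratic relations satisfied by the generators \<open>g\<close> of \<open>P\<close>.\<close>

definition quadratic_rels ::
  "('k::field, 'a) operad \<Rightarrow> 'g collection \<Rightarrow> ('g \<Rightarrow> 'a) \<Rightarrow> ('g ptree \<Rightarrow>\<^sub>0 'k) set" where
  "quadratic_rels P E g = {x \<in> quadratic E. eval P g x = zer P}"

text \<open>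
  The basis of \<open>s\<^sup>-\<^sup>1 S\<^sup>-\<^sup>1 \<otimes> E\<^sup>*\<close> dual to that of \<open>E\<close>: the element dual to \<open>b\<close> carries the label
  \<open>b\<close>.  This requires \<open>E\<close> to be finite in each arity.
\<close>

definition dual_collection :: "'g collection \<Rightarrow> 'g collection" where
  "dual_collection E = E\<lparr>gdeg := \<lambda>b. - 1 + end_deg (- 1) (gar E b) - gdeg E b\<rparr>"

text \<open>
  The value of the pairing on the composite of the elements dual to \<open>b\<close> and \<open>c\<close> and the composite of
  \<open>b\<close> and \<open>c\<close>, all at input \<open>i\<close>.  Write \<open>\<tau>\<^sub>n\<close> for the generator of \<open>S\<^sup>-\<^sup>1(n)\<close>, \<open>b'\<close> for
  \<open>s\<^sup>-\<^sup>1 b\<^sup>*\<close>, and let \<open>b\<close>, \<open>c\<close> have arities \<open>m\<close>, \<open>n\<close>.  The four Koszul signs come from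
  \<^item> the Hadamard product: \<open>(\<tau>\<^sub>m \<otimes> b') \<circ>\<^sub>i (\<tau>\<^sub>n \<otimes> c')\<close> becomes
    \<open>(\<tau>\<^sub>m \<circ>\<^sub>i \<tau>\<^sub>n) \<otimes> (b' \<circ>\<^sub>i c')\<close>;
  \<^item> the composition \<open>\<tau>\<^sub>m \<circ>\<^sub>i \<tau>\<^sub>n\<close> in \<open>S\<^sup>-\<^sup>1\<close>;
  \<^item> the pairing of \<open>b' \<circ>\<^sub>i c'\<close> with \<open>sb \<circ>\<^sub>i sc\<close>;
  \<^item> the identification of \<open>s\<^sup>2 (b \<circ>\<^sub>i c)\<close> with \<open>sb \<circ>\<^sub>i sc\<close>.
\<close>

definition pairing_sign :: "'g collection \<Rightarrow> 'g \<Rightarrow> nat \<Rightarrow> 'g \<Rightarrow> 'k::field" where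
  "pairing_sign E b i c =
     koszul (- 1 - gdeg E b) (end_deg (- 1) (gar E c)) *
     end_sign (- 1) i (gar E c) *
     koszul (- 1 - gdeg E c) (1 + gdeg E b) *
     koszul 1 (gdeg E b)"

definition pairing :: "'g collection \<Rightarrow> ('g ptree \<Rightarrow>\<^sub>0 'k::field) \<Rightarrow> ('g ptree \<Rightarrow>\<^sub>0 'k) \<Rightarrow> 'k" where
  "pairing E y x = (\<Sum>(b, i, c) | b \<in> gset E \<and> c \<in> gset E \<and> 1 \<le> i \<and> i \<le> gar E b \<and>
       graft (corolla E b) i (corolla E c) \<in> Poly_Mapping.keys x.
     pairing_sign E b i c * Poly_Mapping.lookup y (graft (corolla E b) i (corolla E c))
       * Poly_Mapping.lookup x (graft (corolla E b) i (corolla E c)))"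

definition orthogonal ::
  "'g collection \<Rightarrow> ('g ptree \<Rightarrow>\<^sub>0 'k::field) set \<Rightarrow> ('g ptree \<Rightarrow>\<^sub>0 'k) set" where
  "orthogonal E R = {y \<in> quadratic (dual_collection E). \<forall>x\<in>R. pairing E y x = 0}"

definition koszul_dual ::
  "'g collection \<Rightarrow> ('g ptree \<Rightarrow>\<^sub>0 'k) set \<Rightarrow> ('k::field, ('g ptree \<Rightarrow>\<^sub>0 'k) set) operad" where
  "koszul_dual E R = presented_operad (dual_collection E) (orthogonal E R)"


section \<open>The operads ncGrav and ncHyperCom\<close>

text \<open>The generator of arity \<open>k\<close> is labelled by the number \<open>k\<close>.\<close>

definition ncGrav_gens :: "nat collection" where
  "ncGrav_gens = \<lparr>gset = {2..}, gar = (\<lambda>k. k), gdeg = (\<lambda>k. 1)\<rparr>"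

definition ncGrav_rels :: "(nat ptree \<Rightarrow>\<^sub>0 'k::field) set" where
  "ncGrav_rels =
     {(\<Sum>j=r..r+k-2. gen_comp ncGrav_gens (n - 1) j 2) - gen_comp ncGrav_gens (n - k + 1) r k
        | n k r. n \<ge> 4 \<and> 3 \<le> k \<and> k < n \<and> 1 \<le> r \<and> r \<le> n - k + 1} \<union>
     {\<Sum>j=1..n-1. gen_comp ncGrav_gens (n - 1) j 2 | n. n \<ge> 3}"

definition ncGrav :: "('k::field, (nat ptree \<Rightarrow>\<^sub>0 'k) set) operad" where
  "ncGrav = presented_operad ncGrav_gens ncGrav_rels"

text \<open>
  The suspension of \<open>ncGrav\<close> is quadratic, with generators the suspensions of those of
  \<open>ncGrav\<close>; its Koszul dual is taken with respect to these generators and the quadratic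
  relations between them.
\<close>

definition SncGrav_gens :: "nat collection" where
  "SncGrav_gens = susp_collection ncGrav_gens"

definition SncGrav_rels :: "(nat ptree \<Rightarrow>\<^sub>0 'k::field) set" where
  "SncGrav_rels = quadratic_rels (suspension ncGrav) SncGrav_gens
     (susp_gen ncGrav ncGrav_gens (gen_class ncGrav_gens ncGrav_rels))"

definition ncHyperCom :: "('k::field, (nat ptree \<Rightarrow>\<^sub>0 'k) set) operad" where
  "ncHyperCom = koszul_dual SncGrav_gens SncGrav_rels"

definition nu_gens :: "nat collection" where
  "nu_gens = \<lparr>gset = {2..}, gar = (\<lambda>k. k), gdeg = (\<lambda>k. 2 * int k - 4)\<rparr>"

end

theory Submission
  imports Defs
begin

text \<open>
  In weight two and arity \<open>n\<close> the free operads on the generators of arities \<open>k \<ge> 2\<close> have a basis of trees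
  \<open>(m, i, k)\<close> with \<open>m + k = n + 1\<close>, standing for \<open>\<lambda>\<^sub>m \<circ>\<^sub>i \<lambda>\<^sub>k\<close>.  The signs from the suspension and from the pairing
  multiply to \<open>(- 1)\<^sup>n\<close>, so they may be ignored arity by arity.  A functional \<open>y\<close> kills the relations of ncGrav
  iff \<open>y(m, r, k) = a\<^sub>r + \<dots> + a\<^bsub>r+k-2\<^esub>\<close> with \<open>a\<^sub>j = y(n - 1, j, 2)\<close> and \<open>a\<^sub>1 + \<dots> + a\<^bsub>n-1\<^esub> = 0\<close>.  For
  \<open>2 \<le> i \<le> n - 1\<close>, taking \<open>a\<^bsub>i-1\<^esub> = 1\<close>, \<open>a\<^sub>i = - 1\<close> and zero elsewhere gives
  \<open>y(m, r, k) = [r + k - 1 = i] - [r = i]\<close>, which is the \<open>i\<close>-th relation of ncHyperCom, and these choices span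
  all \<open>a\<close> of sum zero.
\<close>


text \<open>The relations of the suspension are not given by a formula: \<open>SncGrav_rels\<close>
  consists of all quadratic elements that evaluate to zero in \<open>suspension ncGrav\<close>, a
  quotient by tensor relations built over a quotient by an ideal. Two facts unwind this. Tensoring
  with the generator of the line detects zero, so up to signs an element evaluates to zero exactly
  when it lies in the ideal of ncGrav. And a functional concentrated in weight two that kills the
  generating relations kills the whole ideal, because composing with anything but the identity
  leaves weight two. Hence orthogonality can be tested on the generating relations alone. What
  remains is discrete integration. With \<open>s i = a 1 + ... + a (i - 1)\<close> the coefficient
  of a functional at the tree \<open>(m, r, k)\<close> is \<open>s (r + k - 1) - s r\<close>, total
  sum zero means \<open>s n = s 1 = 0\<close>, and \<open>s 2, ..., s (n - 1)\<close> are the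
  coefficients with respect to the relations of ncHyperCom. This is why their index runs from 2 to
  \<open>n - 1\<close>.\<close>

section \<open>Linear and bilinear extension\<close>

lemma lookup_scale [simp]:
  "Poly_Mapping.lookup (scale c x) t = c * Poly_Mapping.lookup x t"
  by (simp add: scale_def Poly_Mapping.map.rep_eq when_def)

lemma scale_add [simp]: "scale c (x + y) = scale c x + scale c y"
  by (rule poly_mapping_eqI) (simp add: lookup_add algebra_simps)

lemma scale_add_left: "scale (c + d) x = scale c x + scale d x"
  by (rule poly_mapping_eqI) (simp add: lookup_add algebra_simps)

lemma scale_diff: "scale c (x - y) = scale c x - scale c y"
  by (rule poly_mapping_eqI) (simp add: lookup_minus algebra_simps)

lemma scale_scale [simp]: "scale c (scale d x) = scale (c * d) x"
  by (rule poly_mapping_eqI) (simp add: algebra_simps)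

lemma scale_one [simp]: "scale 1 x = x"
  by (rule poly_mapping_eqI) simp

lemma scale_minus_one: "scale (- 1) x = - x"
  by (rule poly_mapping_eqI) simp

lemma scale_zero [simp]: "scale c 0 = 0" "scale 0 x = 0"
  by (rule poly_mapping_eqI, simp)+

lemma scale_single [simp]: "scale c (Poly_Mapping.single t a) = Poly_Mapping.single t (c * a)"
  by (rule poly_mapping_eqI) (simp add: lookup_single when_def)

lemma scale_sum: "scale c (\<Sum>i\<in>S. g i) = (\<Sum>i\<in>S. scale c (g i))"
  by (induction S rule: infinite_finite_induct) auto

lemma keys_scale: "Poly_Mapping.keys (scale c x) \<subseteq> Poly_Mapping.keys x"
  by (auto simp: in_keys_iff)

text \<open>An element is the sum of its monomials, added one at a time. The set \<open>B\<close> is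
  carried along because homogeneity is a condition on keys and has to be available for each
  monomial.\<close>

lemma keys_induct [consumes 1, case_names zero single_add]:
  fixes x :: "'b \<Rightarrow>\<^sub>0 'c::comm_monoid_add"
  assumes "Poly_Mapping.keys x \<subseteq> B"
    and "Q 0"
    and step: "\<And>t c x. t \<in> B \<Longrightarrow> Poly_Mapping.keys x \<subseteq> B \<Longrightarrow> Q x \<Longrightarrow> Q (Poly_Mapping.single t c + x)"
  shows "Q x"
proof -
  have "finite S \<Longrightarrow> S \<subseteq> B \<Longrightarrow>
      Q (\<Sum>t\<in>S. Poly_Mapping.single t (Poly_Mapping.lookup x t))" for S
  proof (induction S rule: finite_induct)
    case (insert t S)
    have "Poly_Mapping.keys (\<Sum>t\<in>S. Poly_Mapping.single t (Poly_Mapping.lookup x t)) \<subseteq> B"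
      using keys_sum[of "\<lambda>t. Poly_Mapping.single t (Poly_Mapping.lookup x t)" S] insert.prems
      by (fastforce split: if_splits)
    then show ?case using insert step by simp
  qed (simp add: assms)
  moreover have "(\<Sum>t\<in>Poly_Mapping.keys x. Poly_Mapping.single t (Poly_Mapping.lookup x t)) = x"
    by (rule poly_mapping_eqI) (simp add: lookup_sum lookup_single when_def in_keys_iff)
  ultimately show ?thesis using assms(1) by (metis finite_keys)
qed

text \<open>Keys may cancel under addition, so the sums defining \<open>bilin\<close> for
  \<open>x\<close>, \<open>x'\<close> and \<open>x + x'\<close> range over different sets. Over a
  common finite superset only zero terms are added, and the sums can be compared termwise.\<close>

lemma bilin_superset:
  assumes "finite S" "finite T" "Poly_Mapping.keys x \<subseteq> S" "Poly_Mapping.keys y \<subseteq> T"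
  shows "bilin f x y = (\<Sum>s\<in>S. \<Sum>t\<in>T.
    scale (Poly_Mapping.lookup x s * Poly_Mapping.lookup y t) (f s t))"
proof -
  have "(\<Sum>s\<in>S. \<Sum>t\<in>T. scale (Poly_Mapping.lookup x s * Poly_Mapping.lookup y t) (f s t)) =
    (\<Sum>s\<in>S. \<Sum>t\<in>Poly_Mapping.keys y. scale (Poly_Mapping.lookup x s * Poly_Mapping.lookup y t) (f s t))"
    using assms by (intro sum.cong sum.mono_neutral_right) (auto simp: in_keys_iff)
  also have "\<dots> = (\<Sum>s\<in>Poly_Mapping.keys x. \<Sum>t\<in>Poly_Mapping.keys y. scale (Poly_Mapping.lookup x s * Poly_Mapping.lookup y t) (f s t))"
    using assms by (intro sum.mono_neutral_right) (auto simp: in_keys_iff)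
  finally show ?thesis by (simp add: bilin_def)
qed

lemma bilin_zero [simp]: "bilin f 0 y = 0" "bilin f x 0 = 0"
  by (simp_all add: bilin_def)

lemma bilin_add_left: "bilin f (x + x') y = bilin f x y + bilin f x' y"
proof -
  let ?S = "Poly_Mapping.keys x \<union> Poly_Mapping.keys x'"
  have "Poly_Mapping.keys (x + x') \<subseteq> ?S" by (rule Poly_Mapping.keys_add)
  then show ?thesis
    by (simp add: bilin_superset[of ?S "Poly_Mapping.keys y"] lookup_add distrib_right
        scale_add_left sum.distrib)
qed

lemma bilin_add_right: "bilin f x (y + y') = bilin f x y + bilin f x y'"
proof -
  let ?S = "Poly_Mapping.keys y \<union> Poly_Mapping.keys y'"
  have "Poly_Mapping.keys (y + y') \<subseteq> ?S" by (rule Poly_Mapping.keys_add)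
  then show ?thesis
    by (simp add: bilin_superset[of "Poly_Mapping.keys x" ?S] lookup_add distrib_left
        scale_add_left sum.distrib)
qed

lemma bilin_scale_left: "bilin f (scale c x) y = scale c (bilin f x y)"
  by (simp add: bilin_superset[of "Poly_Mapping.keys x" "Poly_Mapping.keys y"] keys_scale
      scale_sum mult.assoc)

lemma bilin_scale_right: "bilin f x (scale c y) = scale c (bilin f x y)"
  by (simp add: bilin_superset[of "Poly_Mapping.keys x" "Poly_Mapping.keys y"] keys_scale
      scale_sum mult.assoc mult.left_commute)

lemma bilin_diff_left: "bilin f (x - x') y = bilin f x y - bilin f x' y"
  using bilin_add_left[of f "x - x'" x' y] by simp

lemma bilin_diff_right: "bilin f x (y - y') = bilin f x y - bilin f x y'"
  using bilin_add_right[of f x "y - y'" y'] by simp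

lemma bilin_single [simp]:
  "bilin f (Poly_Mapping.single s a) (Poly_Mapping.single t b) = scale (a * b) (f s t)"
  by (simp add: bilin_superset[of "{s}" "{t}"])

lemma keys_bilin:
  assumes "\<And>s t. s \<in> Poly_Mapping.keys x \<Longrightarrow> t \<in> Poly_Mapping.keys y \<Longrightarrow> Poly_Mapping.keys (f s t) \<subseteq> B"
  shows "Poly_Mapping.keys (bilin f x y) \<subseteq> B"
proof -
  have "Poly_Mapping.keys (bilin f x y) \<subseteq> (\<Union>s\<in>Poly_Mapping.keys x. \<Union>t\<in>Poly_Mapping.keys y.
      Poly_Mapping.keys (scale (Poly_Mapping.lookup x s * Poly_Mapping.lookup y t) (f s t)))"
    unfolding bilin_def
    by (rule order.trans[OF keys_sum], rule UN_mono[OF subset_refl keys_sum])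
  also have "\<dots> \<subseteq> B"
    using assms keys_scale by fast
  finally show ?thesis .
qed


section \<open>Koszul signs as bimultiplicative functions of the degrees\<close>

lemma koszul_add_left: "koszul (a + b) c = koszul a c * koszul b c"
  by (auto simp: koszul_def)

lemma koszul_add_right: "koszul a (b + c) = koszul a b * koszul a c"
  by (auto simp: koszul_def)

lemma koszul_zero [simp]: "koszul 0 a = 1" "koszul a 0 = 1"
  by (auto simp: koszul_def)

lemma koszul_commute: "koszul a b = koszul b a"
  by (auto simp: koszul_def)

lemma koszul_square [simp]: "koszul a b * koszul a b = 1" "koszul a b * (koszul a b * c) = c"
  by (auto simp: koszul_def)


section \<open>Operads with a homogeneous basis\<close>

text \<open>The common shape of the free operad, the formal tensors and the endomorphism operad of a
  line: linear combinations of basis elements, composed by bilinear extension. Input positions out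
  of range are included, since an ideal is later closed under composition at every position.\<close>

locale based_operad =
  fixes P :: "('k::field, 'b \<Rightarrow>\<^sub>0 'k) operad" and B :: "nat \<Rightarrow> int \<Rightarrow> 'b set"
    and f :: "nat \<Rightarrow> 'b \<Rightarrow> 'b \<Rightarrow> 'b \<Rightarrow>\<^sub>0 'k"
  assumes zer [simp]: "zer P = 0" and add [simp]: "add P = (+)" and smul [simp]: "smul P = scale"
    and homog: "homog P n d = {x. Poly_Mapping.keys x \<subseteq> B n d}"
    and pcomp: "pcomp P x i y = bilin (f i) x y"
    and out_of_range: "t \<in> B m d \<Longrightarrow> \<not> (1 \<le> i \<and> i \<le> m) \<Longrightarrow> f i t u = 0"
    and keys_comp: "t \<in> B m d \<Longrightarrow> u \<in> B n e \<Longrightarrow> 1 \<le> i \<Longrightarrow> i \<le> m \<Longrightarrow>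
      Poly_Mapping.keys (f i t u) \<subseteq> B (m + n - 1) (d + e)"
begin

definition basis :: "'b set" where
  "basis = (\<Union>n d. B n d)"

lemma graded_space: "graded_space P"
proof -
  have "x + y \<in> homog P n d" "scale a x \<in> homog P n d"
    if "x \<in> homog P n d" "y \<in> homog P n d" for x y n d a
    using that keys_scale[of a x] Poly_Mapping.keys_add[of x y] unfolding homog by blast+
  moreover have "0 \<in> homog P n d" for n d
    by (simp add: homog)
  ultimately show ?thesis
    by (simp add: graded_space_def scale_add_left scale_minus_one add.commute add.assoc)
qed

lemma pcomp_homog:
  assumes "x \<in> homog P m d" "y \<in> homog P n e" "1 \<le> i" "i \<le> m"
  shows "pcomp P x i y \<in> homog P (m + n - 1) (d + e)"
  using assms unfolding homog pcomp mem_Collect_eq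
  by (intro keys_bilin keys_comp) auto

lemma bilinear_comp: "bilinear_comp P"
  unfolding bilinear_comp_def
  using pcomp_homog
  by (auto simp: pcomp bilin_add_left bilin_add_right bilin_scale_left bilin_scale_right)

lemma pcomp_out_of_range:
  assumes "x \<in> homog P m d" "\<not> (1 \<le> i \<and> i \<le> m)"
  shows "pcomp P x i y = 0"
  using assms unfolding homog pcomp bilin_def mem_Collect_eq
  by (intro sum.neutral ballI) (simp add: subset_iff out_of_range[of _ m d i])

lemma pcomp_linear:
  "pcomp P (x + x') i y = pcomp P x i y + pcomp P x' i y"
  "pcomp P x i (y + y') = pcomp P x i y + pcomp P x i y'"
  "pcomp P (x - x') i y = pcomp P x i y - pcomp P x' i y"
  "pcomp P x i (y - y') = pcomp P x i y - pcomp P x i y'"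
  "pcomp P (scale c x) i y = scale c (pcomp P x i y)"
  "pcomp P x i (scale c y) = scale c (pcomp P x i y)"
  "pcomp P 0 i y = 0" "pcomp P x i 0 = 0"
  by (simp_all add: pcomp bilin_add_left bilin_add_right bilin_diff_left bilin_diff_right
      bilin_scale_left bilin_scale_right)

lemma homog_basis: "x \<in> homog P n d \<Longrightarrow> Poly_Mapping.keys x \<subseteq> basis"
  by (auto simp: homog basis_def)

lemma unital_compI:
  assumes "ident P \<in> homog P 1 0"
    and "\<And>n d t. t \<in> B n d \<Longrightarrow> pcomp P (ident P) 1 (Poly_Mapping.single t 1) = Poly_Mapping.single t 1"
    and "\<And>n d t i. t \<in> B n d \<Longrightarrow> 1 \<le> i \<Longrightarrow> i \<le> n \<Longrightarrow>
      pcomp P (Poly_Mapping.single t 1) i (ident P) = Poly_Mapping.single t 1"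
  shows "unital_comp P"
proof -
  have "pcomp P (ident P) 1 x = x" if "x \<in> homog P n d" for x n d
    using that unfolding homog mem_Collect_eq
  proof (induction rule: keys_induct)
    case (single_add t c x)
    have "Poly_Mapping.single t c = scale c (Poly_Mapping.single t 1)" by simp
    with single_add assms(2) show ?case
      unfolding pcomp bilin_add_right by (metis bilin_scale_right)
  qed (simp add: pcomp)
  moreover have "pcomp P x i (ident P) = x" if "x \<in> homog P n d" "1 \<le> i" "i \<le> n" for x n d i
    using that(1) unfolding homog mem_Collect_eq
  proof (induction rule: keys_induct)
    case (single_add t c x)
    have "Poly_Mapping.single t c = scale c (Poly_Mapping.single t 1)" by simp
    with single_add assms(3) that show ?case
      unfolding pcomp bilin_add_left by (metis bilin_scale_left)
  qed (simp add: pcomp)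
  ultimately show ?thesis
    using assms(1) by (auto simp: unital_comp_def)
qed

text \<open>Two trilinear maps that agree on basis elements agree; three nested inductions over the
  keys, beginning with the last argument. \<open>F\<close> and \<open>G\<close> are abstract so that
  both associativity laws are instances.\<close>

lemma trilinear_eqI:
  assumes "\<And>t u v. t \<in> B l a \<Longrightarrow> u \<in> B m b \<Longrightarrow> v \<in> B n c \<Longrightarrow>
      F (Poly_Mapping.single t 1) (Poly_Mapping.single u 1) (Poly_Mapping.single v 1)
      = G (Poly_Mapping.single t 1) (Poly_Mapping.single u 1) (Poly_Mapping.single v 1)"
    and "\<And>y z. F 0 y z = 0" "\<And>x z. F x 0 z = 0" "\<And>x y. F x y 0 = 0"
    and "\<And>y z. G 0 y z = 0" "\<And>x z. G x 0 z = 0" "\<And>x y. G x y 0 = 0"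
    and "\<And>d x x' y z. F (scale d x + x') y z = scale d (F x y z) + F x' y z"
    and "\<And>d x y y' z. F x (scale d y + y') z = scale d (F x y z) + F x y' z"
    and "\<And>d x y z z'. F x y (scale d z + z') = scale d (F x y z) + F x y z'"
    and "\<And>d x x' y z. G (scale d x + x') y z = scale d (G x y z) + G x' y z"
    and "\<And>d x y y' z. G x (scale d y + y') z = scale d (G x y z) + G x y' z"
    and "\<And>d x y z z'. G x y (scale d z + z') = scale d (G x y z) + G x y z'"
    and "x \<in> homog P l a" "y \<in> homog P m b" "z \<in> homog P n c"
  shows "F x y z = (G x y z :: 'b \<Rightarrow>\<^sub>0 'k)"
proof -
  \<comment> \<open>The induction supplies monomials with arbitrary coefficients, whereas agreement
    is assumed for coefficient 1 only.\<close>
  have single: "Poly_Mapping.single t e = scale e (Poly_Mapping.single t 1)" for t :: 'b and e :: 'k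
    by simp
  have 1: "F (Poly_Mapping.single t 1) (Poly_Mapping.single u 1) z
      = G (Poly_Mapping.single t 1) (Poly_Mapping.single u 1) z"
    if "t \<in> B l a" "u \<in> B m b" for t u
    using assms(16) unfolding homog mem_Collect_eq
  proof (induction rule: keys_induct)
    case (single_add v e z)
    then show ?case
      using assms(1)[OF that] by (subst (1 2) single) (simp add: assms(10,13) del: scale_single)
  qed (simp add: assms)
  have 2: "F (Poly_Mapping.single t 1) y z = G (Poly_Mapping.single t 1) y z"
    if "t \<in> B l a" for t
    using assms(15) unfolding homog mem_Collect_eq
  proof (induction rule: keys_induct)
    case (single_add v e z)
    then show ?case
      using 1[OF that] by (subst (1 2) single) (simp add: assms(9,12) del: scale_single)
  qed (simp add: assms)
  show ?thesis
    using assms(14) unfolding homog mem_Collect_eq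
  proof (induction rule: keys_induct)
    case (single_add v e z)
    then show ?case
      using 2 by (subst (1 2) single) (simp add: assms(8,11) del: scale_single)
  qed (simp add: assms)
qed

lemma associative_compI:
  assumes "\<And>l a m b n c t u v i j. t \<in> B l a \<Longrightarrow> u \<in> B m b \<Longrightarrow> v \<in> B n c \<Longrightarrow>
      1 \<le> i \<Longrightarrow> i \<le> l \<Longrightarrow> 1 \<le> j \<Longrightarrow> j \<le> m \<Longrightarrow>
      pcomp P (pcomp P (Poly_Mapping.single t 1) i (Poly_Mapping.single u 1)) (i - 1 + j) (Poly_Mapping.single v 1)
      = pcomp P (Poly_Mapping.single t 1) i (pcomp P (Poly_Mapping.single u 1) j (Poly_Mapping.single v 1))"
    and "\<And>l a m b n c t u v i k. t \<in> B l a \<Longrightarrow> u \<in> B m b \<Longrightarrow> v \<in> B n c \<Longrightarrow>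
      1 \<le> i \<Longrightarrow> i < k \<Longrightarrow> k \<le> l \<Longrightarrow>
      pcomp P (pcomp P (Poly_Mapping.single t 1) i (Poly_Mapping.single u 1)) (k - 1 + m) (Poly_Mapping.single v 1)
      = scale (koszul b c) (pcomp P (pcomp P (Poly_Mapping.single t 1) k (Poly_Mapping.single v 1)) i (Poly_Mapping.single u 1))"
  shows "associative_comp P"
proof -
  note lin = pcomp bilin_add_left bilin_add_right bilin_scale_left bilin_scale_right
  show ?thesis
    unfolding associative_comp_def
  proof (intro allI ballI conjI impI; (elim conjE)?)
    fix l a m b n c x y z i j
    assume xyz: "x \<in> homog P l a" "y \<in> homog P m b" "z \<in> homog P n c"
      and ij: "1 \<le> i" "i \<le> l" "1 \<le> j" "j \<le> m"
    show "pcomp P (pcomp P x i y) (i - 1 + j) z = pcomp P x i (pcomp P y j z)"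
      by (rule trilinear_eqI[where F = "\<lambda>x y z. pcomp P (pcomp P x i y) (i - 1 + j) z"
            and G = "\<lambda>x y z. pcomp P x i (pcomp P y j z)", OF assms(1) _ _ _ _ _ _ _ _ _ _ _ _ xyz])
        (use ij in \<open>simp_all add: lin\<close>)
  next
    fix l a m b n c x y z i k
    assume xyz: "x \<in> homog P l a" "y \<in> homog P m b" "z \<in> homog P n c"
      and ik: "1 \<le> i" "i < k" "k \<le> l"
    show "pcomp P (pcomp P x i y) (k - 1 + m) z
        = smul P (koszul b c) (pcomp P (pcomp P x k z) i y)"
      unfolding smul
      by (rule trilinear_eqI[where F = "\<lambda>x y z. pcomp P (pcomp P x i y) (k - 1 + m) z"
            and G = "\<lambda>x y z. scale (koszul b c) (pcomp P (pcomp P x k z) i y)",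
            OF assms(2) _ _ _ _ _ _ _ _ _ _ _ _ xyz])
        (use ik in \<open>simp_all add: lin mult.commute\<close>)
  qed
qed

end


section \<open>Quotients by congruences\<close>

text \<open>Covers operadic ideals as well as \<open>tensor_rels\<close>, which is defined as a mere
  linear span. \<open>I_basis\<close> matters because two representatives of a composite also differ
  by a composite of two elements of \<open>I\<close>, and such a composite is controlled only if its
  factors are combinations of basis elements.\<close>

locale operad_congruence = based_operad P B f
  for P :: "('k::field, 'b \<Rightarrow>\<^sub>0 'k) operad" and B :: "nat \<Rightarrow> int \<Rightarrow> 'b set"
    and f :: "nat \<Rightarrow> 'b \<Rightarrow> 'b \<Rightarrow> 'b \<Rightarrow>\<^sub>0 'k" +
  fixes I :: "('b \<Rightarrow>\<^sub>0 'k) set"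
  assumes I_zero [simp]: "0 \<in> I"
    and I_add: "x \<in> I \<Longrightarrow> y \<in> I \<Longrightarrow> x + y \<in> I"
    and I_scale: "x \<in> I \<Longrightarrow> scale c x \<in> I"
    and I_basis: "x \<in> I \<Longrightarrow> Poly_Mapping.keys x \<subseteq> basis"
    and I_comp_left: "x \<in> I \<Longrightarrow> t \<in> basis \<Longrightarrow> pcomp P x i (Poly_Mapping.single t 1) \<in> I"
    and I_comp_right: "x \<in> I \<Longrightarrow> t \<in> basis \<Longrightarrow> pcomp P (Poly_Mapping.single t 1) i x \<in> I"
begin

abbreviation cls :: "('b \<Rightarrow>\<^sub>0 'k) \<Rightarrow> ('b \<Rightarrow>\<^sub>0 'k) set" where
  "cls \<equiv> coset P I"

lemma I_uminus: "x \<in> I \<Longrightarrow> - x \<in> I"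
  using I_scale[of x "- 1"] by (simp add: scale_minus_one)

lemma I_diff: "x \<in> I \<Longrightarrow> y \<in> I \<Longrightarrow> x - y \<in> I"
  using I_add[OF _ I_uminus] by fastforce

lemma I_sum: "(\<And>i. i \<in> S \<Longrightarrow> g i \<in> I) \<Longrightarrow> (\<Sum>i\<in>S. g i) \<in> I"
  by (induction S rule: infinite_finite_induct) (auto intro: I_add)

lemma mem_cls: "y \<in> cls x \<longleftrightarrow> y - x \<in> I"
  by (force simp: coset_def)

lemma mem_self: "x \<in> cls x"
  by (simp add: mem_cls)

lemma cls_eq_iff: "cls x = cls y \<longleftrightarrow> x - y \<in> I"
proof
  show "x - y \<in> I" if "cls x = cls y"
    using that mem_cls[of x x] mem_cls[of x y] by simp
next
  assume xy: "x - y \<in> I"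
  have "z - x \<in> I \<longleftrightarrow> z - y \<in> I" for z
    using I_add[OF _ xy, of "z - x"] I_diff[OF _ xy, of "z - y"] by auto
  then show "cls x = cls y"
    by (auto simp: mem_cls)
qed

lemma cls_eq_zero_iff: "cls x = cls 0 \<longleftrightarrow> x \<in> I"
  by (simp add: cls_eq_iff)

lemma pcomp_left_mem:
  assumes "x \<in> I" "Poly_Mapping.keys y \<subseteq> basis"
  shows "pcomp P x i y \<in> I"
  using assms(2)
proof (induction rule: keys_induct)
  case (single_add t c y)
  have "pcomp P x i (Poly_Mapping.single t c) = scale c (pcomp P x i (Poly_Mapping.single t 1))"
    unfolding pcomp bilin_scale_right[symmetric] by simp
  then show ?case
    using single_add I_comp_left[OF assms(1), of t i]
    by (simp add: pcomp bilin_add_right I_add I_scale)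
qed (simp add: pcomp)

lemma pcomp_right_mem:
  assumes "x \<in> I" "Poly_Mapping.keys y \<subseteq> basis"
  shows "pcomp P y i x \<in> I"
  using assms(2)
proof (induction rule: keys_induct)
  case (single_add t c y)
  have "pcomp P (Poly_Mapping.single t c) i x = scale c (pcomp P (Poly_Mapping.single t 1) i x)"
    unfolding pcomp bilin_scale_left[symmetric] by simp
  then show ?case
    using single_add I_comp_right[OF assms(1), of t i]
    by (simp add: pcomp bilin_add_left I_add I_scale)
qed (simp add: pcomp)

lemma quot_zer [simp]: "zer (quot P I) = cls 0"
  and quot_ident [simp]: "ident (quot P I) = cls (ident P)"
  and quot_homog: "homog (quot P I) n d = cls ` homog P n d"
  by (simp_all add: quot_def)

text \<open>The union in the definition of \<open>quot\<close> runs over a nonempty constant family: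
  other representatives change the sum by an element of \<open>I\<close>. The same pattern serves
  \<open>smul\<close> and \<open>pcomp\<close>.\<close>

lemma quot_add [simp]: "add (quot P I) (cls x) (cls y) = cls (x + y)"
proof -
  have "cls (x' + y') = cls (x + y)" if "x' \<in> cls x" "y' \<in> cls y" for x' y'
    using I_add[OF that[unfolded mem_cls]] by (simp add: cls_eq_iff algebra_simps)
  then have "(\<Union>x'\<in>cls x. \<Union>y'\<in>cls y. cls (x' + y')) = cls (x + y)"
    by (intro UN_constant_eq[OF mem_self] ballI)
  then show ?thesis
    by (simp add: quot_def)
qed

lemma quot_smul [simp]: "smul (quot P I) c (cls x) = cls (scale c x)"
proof -
  have "cls (scale c x') = cls (scale c x)" if "x' \<in> cls x" for x'
    using I_scale[OF that[unfolded mem_cls], of c] by (simp add: cls_eq_iff scale_diff)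
  then have "(\<Union>x'\<in>cls x. cls (scale c x')) = cls (scale c x)"
    by (intro UN_constant_eq[OF mem_self] ballI)
  then show ?thesis
    by (simp add: quot_def)
qed

lemma quot_pcomp:
  assumes "Poly_Mapping.keys x \<subseteq> basis" "Poly_Mapping.keys y \<subseteq> basis"
  shows "pcomp (quot P I) (cls x) i (cls y) = cls (pcomp P x i y)"
proof -
  have "cls (pcomp P x' i y') = cls (pcomp P x i y)" if "x' \<in> cls x" "y' \<in> cls y" for x' y'
  proof -
    define a b where "a = x' - x" and "b = y' - y"
    have ab: "a \<in> I" "b \<in> I"
      using that by (simp_all add: mem_cls a_def b_def)
    \<comment> \<open>Expansion of the composite of \<open>x + a\<close> and \<open>y + b\<close>;
      each of the three terms has a factor in \<open>I\<close>.\<close>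
    have "pcomp P x' i y' - pcomp P x i y = pcomp P a i b + pcomp P a i y + pcomp P x i b"
      unfolding pcomp a_def b_def bilin_diff_left bilin_diff_right by simp
    moreover have "pcomp P a i b \<in> I" "pcomp P a i y \<in> I" "pcomp P x i b \<in> I"
      using pcomp_left_mem[OF ab(1) I_basis[OF ab(2)]] pcomp_left_mem[OF ab(1) assms(2)]
        pcomp_right_mem[OF ab(2) assms(1)] by blast+
    ultimately show ?thesis
      by (simp add: cls_eq_iff I_add)
  qed
  then have "(\<Union>x'\<in>cls x. \<Union>y'\<in>cls y. cls (pcomp P x' i y')) = cls (pcomp P x i y)"
    by (intro UN_constant_eq[OF mem_self] ballI)
  then show ?thesis
    by (simp add: quot_def)
qed

lemma quot_pcomp_homog:
  "x \<in> homog P m d \<Longrightarrow> y \<in> homog P n e \<Longrightarrow>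
    pcomp (quot P I) (cls x) i (cls y) = cls (pcomp P x i y)"
  by (intro quot_pcomp homog_basis)

lemma ns_operad_quot:
  assumes "ns_operad P"
  shows "ns_operad (quot P I)"
proof -
  note comp = quot_pcomp_homog
  have graded: "graded_space (quot P I)"
    using graded_space
    by (simp add: graded_space_def quot_homog ac_simps scale_add_left scale_minus_one)
  have bil: "bilinear_comp P" and unit: "unital_comp P" and assoc: "associative_comp P"
    using assms by (simp_all add: ns_operad_def)
  have hom: "x + y \<in> homog P n d" "scale a x \<in> homog P n d"
    if "x \<in> homog P n d" "y \<in> homog P n d" for x y n d a
    using graded_space that unfolding graded_space_def by auto
  have "bilinear_comp (quot P I)"
    unfolding bilinear_comp_def
  proof (intro allI impI ballI; elim conjE)
    fix m d n e i X Y
    assume *: "X \<in> homog (quot P I) m d" "Y \<in> homog (quot P I) n e" "1 \<le> i" "i \<le> m"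
    then obtain x y where xy: "x \<in> homog P m d" "y \<in> homog P n e" "X = cls x" "Y = cls y"
      by (auto simp: quot_homog)
    have "pcomp P x i y \<in> homog P (m + n - 1) (d + e)"
      using pcomp_homog xy * by blast
    moreover have "pcomp P (scale c x) i y = scale c (pcomp P x i y)"
      "pcomp P x i (scale c y) = scale c (pcomp P x i y)" for c
      by (simp_all add: pcomp bilin_scale_left bilin_scale_right)
    moreover have "pcomp P (x + x') i y = pcomp P x i y + pcomp P x' i y"
      "pcomp P x i (y + y') = pcomp P x i y + pcomp P x i y'" for x' y'
      by (simp_all add: pcomp bilin_add_left bilin_add_right)
    ultimately show "pcomp (quot P I) X i Y \<in> homog (quot P I) (m + n - 1) (d + e) \<and>
      (\<forall>c. pcomp (quot P I) (smul (quot P I) c X) i Y = smul (quot P I) c (pcomp (quot P I) X i Y) \<and>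
           pcomp (quot P I) X i (smul (quot P I) c Y) = smul (quot P I) c (pcomp (quot P I) X i Y)) \<and>
      (\<forall>X'\<in>homog (quot P I) m d. pcomp (quot P I) (add (quot P I) X X') i Y =
         add (quot P I) (pcomp (quot P I) X i Y) (pcomp (quot P I) X' i Y)) \<and>
      (\<forall>Y'\<in>homog (quot P I) n e. pcomp (quot P I) X i (add (quot P I) Y Y') =
         add (quot P I) (pcomp (quot P I) X i Y) (pcomp (quot P I) X i Y'))"
      using xy by (auto simp: quot_homog comp[of _ m d _ n e] hom)
  qed
  moreover have "unital_comp (quot P I)"
  proof -
    have id: "ident P \<in> homog P 1 0"
      using unit by (simp add: unital_comp_def)
    show ?thesis
      using unit unfolding unital_comp_def
      by (auto simp: quot_homog comp[OF id] comp[OF _ id])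
  qed
  moreover have "associative_comp (quot P I)"
    unfolding associative_comp_def
  proof (intro allI ballI)
    fix l a m b n c X Y Z
    assume *: "X \<in> homog (quot P I) l a" "Y \<in> homog (quot P I) m b" "Z \<in> homog (quot P I) n c"
    then obtain x y z where xyz: "x \<in> homog P l a" "y \<in> homog P m b" "z \<in> homog P n c"
        "X = cls x" "Y = cls y" "Z = cls z"
      by (auto simp: quot_homog)
    have h: "1 \<le> i \<Longrightarrow> i \<le> l \<Longrightarrow> pcomp P x i y \<in> homog P (l + m - 1) (a + b)"
      "1 \<le> i \<Longrightarrow> i \<le> l \<Longrightarrow> pcomp P x i z \<in> homog P (l + n - 1) (a + c)"
      "1 \<le> i \<Longrightarrow> i \<le> m \<Longrightarrow> pcomp P y i z \<in> homog P (m + n - 1) (b + c)" for i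
      using pcomp_homog xyz by blast+
    have A: "pcomp P (pcomp P x i y) (i - 1 + j) z = pcomp P x i (pcomp P y j z)"
      if "1 \<le> i" "i \<le> l" "1 \<le> j" "j \<le> m" for i j
      using that assoc xyz unfolding associative_comp_def by blast
    have A': "pcomp P (pcomp P x i y) (k - 1 + m) z = scale (koszul b c) (pcomp P (pcomp P x k z) i y)"
      if "1 \<le> i" "i < k" "k \<le> l" for i k
      using that assoc xyz unfolding associative_comp_def smul by blast
    show "(\<forall>i j. 1 \<le> i \<and> i \<le> l \<and> 1 \<le> j \<and> j \<le> m \<longrightarrow>
          pcomp (quot P I) (pcomp (quot P I) X i Y) (i - 1 + j) Z =
          pcomp (quot P I) X i (pcomp (quot P I) Y j Z)) \<and>
       (\<forall>i k. 1 \<le> i \<and> i < k \<and> k \<le> l \<longrightarrow>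
          pcomp (quot P I) (pcomp (quot P I) X i Y) (k - 1 + m) Z =
          smul (quot P I) (koszul b c) (pcomp (quot P I) (pcomp (quot P I) X k Z) i Y))"
    proof (intro conjI allI impI; elim conjE)
      fix i j assume ij: "1 \<le> i" "i \<le> l" "1 \<le> j" "j \<le> m"
      show "pcomp (quot P I) (pcomp (quot P I) X i Y) (i - 1 + j) Z =
          pcomp (quot P I) X i (pcomp (quot P I) Y j Z)"
        unfolding xyz(4-6) comp[OF xyz(1,2)] comp[OF xyz(2,3)]
          comp[OF h(1)[OF ij(1,2)] xyz(3)] comp[OF xyz(1) h(3)[OF ij(3,4)]] A[OF ij] ..
    next
      fix i k assume ik: "1 \<le> i" "i < k" "k \<le> l"
      then have "i \<le> l" "1 \<le> k" by simp_all
      show "pcomp (quot P I) (pcomp (quot P I) X i Y) (k - 1 + m) Z =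
          smul (quot P I) (koszul b c) (pcomp (quot P I) (pcomp (quot P I) X k Z) i Y)"
        unfolding xyz(4-6) comp[OF xyz(1,2)] comp[OF xyz(1,3)]
          comp[OF h(1)[OF ik(1) \<open>i \<le> l\<close>] xyz(3)] comp[OF h(2)[OF \<open>1 \<le> k\<close> ik(3)] xyz(2)]
          A'[OF ik] quot_smul ..
    qed
  qed
  ultimately show ?thesis
    using graded by (simp add: ns_operad_def)
qed

text \<open>\<open>eval\<close> is a \<open>Finite_Set.fold\<close>, which has its intended value
  only if the summands commute as functions. These functions act on arbitrary sets and not only on
  cosets, so commutation has to hold for every set.\<close>

lemma fold_add:
  assumes "finite S" "\<And>t. t \<in> S \<Longrightarrow> g t = cls (h t)"
  shows "Finite_Set.fold (\<lambda>t. add (quot P I) (smul (quot P I) (c t) (g t))) (zer (quot P I)) S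
    = cls (\<Sum>t\<in>S. scale (c t) (h t))"
proof -
  let ?F = "\<lambda>t. add (quot P I) (smul (quot P I) (c t) (g t))"
  \<comment> \<open>Here \<open>Z\<close> is any set, possibly empty or a union of several
    cosets.\<close>
  have add_cls: "add (quot P I) (cls x) Z = {w. \<exists>z\<in>Z. w - (x + z) \<in> I}" for x Z
  proof -
    have "add (quot P I) (cls x) Z = (\<Union>x'\<in>cls x. \<Union>z\<in>Z. cls (x' + z))"
      by (simp add: quot_def)
    moreover have "w - (x + z) \<in> I" if "x' - x \<in> I" "w - (x' + z) \<in> I" for x' z w
      using I_add[OF that] by (simp add: algebra_simps)
    ultimately show ?thesis
      using I_zero by (fastforce simp: mem_cls)
  qed
  have assoc: "add (quot P I) (cls x) (add (quot P I) (cls y) Z) = add (quot P I) (cls (x + y)) Z"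
    for x y Z
  proof -
    have "w - (x + y + z) \<in> I" if "v - (y + z) \<in> I" "w - (x + v) \<in> I" for w v z
      using I_add[OF that] by (simp add: algebra_simps)
    moreover have "\<exists>v. v - (y + z) \<in> I \<and> w - (x + v) \<in> I" if "w - (x + y + z) \<in> I" for w z
      using that by (intro exI[of _ "y + z"]) (simp add: algebra_simps)
    ultimately show ?thesis
      unfolding add_cls by blast
  qed
  have "comp_fun_commute_on S ?F"
  proof
    fix s t assume "s \<in> S" "t \<in> S"
    then show "?F s \<circ> ?F t = ?F t \<circ> ?F s"
      by (simp add: fun_eq_iff assms(2) assoc add.commute)
  qed
  then interpret comp_fun_commute_on S ?F .
  have "T \<subseteq> S \<Longrightarrow> Finite_Set.fold ?F (zer (quot P I)) T = cls (\<Sum>t\<in>T. scale (c t) (h t))"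
    if "finite T" for T
    using that
  proof (induction T rule: finite_induct)
    case (insert t T)
    then have "Finite_Set.fold ?F (zer (quot P I)) (insert t T) =
        ?F t (Finite_Set.fold ?F (zer (quot P I)) T)"
      by (intro fold_insert) auto
    then show ?case
      using insert by (simp add: assms(2))
  qed simp
  then show ?thesis
    using assms(1) by blast
qed

end


text \<open>An ideal is only required to be closed under composition of homogeneous elements, so before composing
  an arbitrary element of it one splits it into homogeneous ones, again from the ideal.\<close>

inductive_set homog_sums :: "('k::field, 'a) operad \<Rightarrow> 'a set \<Rightarrow> 'a set"
  for P :: "('k, 'a) operad" and I :: "'a set" where
  zero: "zer P \<in> homog_sums P I"
| step: "w \<in> I \<Longrightarrow> w \<in> homog P n d \<Longrightarrow> x \<in> homog_sums P I \<Longrightarrow> add P w x \<in> homog_sums P I"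

context based_operad
begin

text \<open>Homogeneous generators keep the ideal inside \<open>homog_sums\<close>: sums and
  multiples are handled summand by summand, and a composite formed by an ideal rule is itself
  homogeneous. Closure under composition is then proved on homogeneous summands.\<close>

lemma operad_congruence_ideal:
  assumes R: "\<And>r. r \<in> R \<Longrightarrow> \<exists>n d. r \<in> homog P n d"
  shows "operad_congruence P B f (operad_ideal P R)"
proof -
  let ?I = "operad_ideal P R"
  have zero: "0 \<in> ?I" and add_mem: "\<And>x y. x \<in> ?I \<Longrightarrow> y \<in> ?I \<Longrightarrow> x + y \<in> ?I"
    and scale_mem: "\<And>c x. x \<in> ?I \<Longrightarrow> scale c x \<in> ?I"
    using operad_ideal.zero[of P R] operad_ideal.add[of _ P R] operad_ideal.smul[of _ P R] by simp_all
  define J where "J = homog_sums P ?I"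
  have J0: "0 \<in> J" and J1: "\<And>w n d x. w \<in> ?I \<Longrightarrow> w \<in> homog P n d \<Longrightarrow> x \<in> J \<Longrightarrow> w + x \<in> J"
    unfolding J_def using homog_sums.zero[of P ?I] homog_sums.step[of _ ?I P] by auto
  have JH: "w \<in> J" if "w \<in> ?I" "w \<in> homog P n d" for w n d
    using J1[OF that J0] by simp
  have hs: "scale c w \<in> homog P n d" if "w \<in> homog P n d" for c w n d
    using that keys_scale[of c w] by (auto simp: homog)
  have J: "x \<in> J" if "x \<in> ?I" for x
    using that
  proof (induction rule: operad_ideal.induct)
    case (rel r)
    then show ?case using R JH operad_ideal.rel by metis
  next
    case zero
    then show ?case by (simp add: J0)
  next
    case (add x y)
    have "x + y \<in> J"
      using add(3)[unfolded J_def]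
    proof induction
      case (step w n d x)
      then show ?case using J1[of w n d "x + y"] by (simp add: add.assoc)
    qed (use add in simp)
    then show ?case by simp
  next
    case (smul x c)
    have "scale c x \<in> J"
      using smul(2)[unfolded J_def]
    proof induction
      case (step w n d x)
      then show ?case using J1[of "scale c w" n d "scale c x"] by (simp add: hs scale_mem)
    qed (simp add: J0)
    then show ?case by simp
  next
    case (comp_left x m d y n e i)
    show ?case
      using JH[OF operad_ideal.comp_left[OF comp_left.hyps] pcomp_homog] comp_left by blast
  next
    case (comp_right y n e x m d i)
    show ?case
      using JH[OF operad_ideal.comp_right[OF comp_right.hyps] pcomp_homog] comp_right by blast
  qed
  have single_homog: "Poly_Mapping.single t 1 \<in> homog P n d" if "t \<in> B n d" for t n d
    using that by (simp add: homog)
  show ?thesis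
  proof (unfold_locales)
    fix x assume x: "x \<in> ?I"
    show "Poly_Mapping.keys x \<subseteq> basis"
      using J[OF x, unfolded J_def]
    proof (induction rule: homog_sums.induct)
      case (step w n d x)
      then show ?case
        using homog_basis[OF step(2)] Poly_Mapping.keys_add[of w x] by auto
    qed simp
    fix t i assume "t \<in> basis"
    then obtain n e where t: "t \<in> B n e" by (auto simp: basis_def)
    show "pcomp P x i (Poly_Mapping.single t 1) \<in> ?I"
      using J[OF x, unfolded J_def]
    proof (induction rule: homog_sums.induct)
      case (step w m d x)
      \<comment> \<open>The ideal rule covers positions in range; at all others the composite is
        zero.\<close>
      have "pcomp P w i (Poly_Mapping.single t 1) \<in> ?I"
        using operad_ideal.comp_left[OF step(1,2) single_homog[OF t]] pcomp_out_of_range[OF step(2)] zero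
        by metis
      then show ?case
        using step add_mem by (simp add: pcomp bilin_add_left)
    qed (simp add: pcomp zero)
    show "pcomp P (Poly_Mapping.single t 1) i x \<in> ?I"
      using J[OF x, unfolded J_def]
    proof (induction rule: homog_sums.induct)
      case (step w m d x)
      have "pcomp P (Poly_Mapping.single t 1) i w \<in> ?I"
        using operad_ideal.comp_right[OF step(1,2) single_homog[OF t]]
          pcomp_out_of_range[OF single_homog[OF t]] zero by metis
      then show ?case
        using step add_mem by (simp add: pcomp bilin_add_right)
    qed (simp add: pcomp zero)
  qed (auto intro: zero add_mem scale_mem)
qed

end

lemma operad_ideal_mono:
  assumes "R \<subseteq> operad_ideal P S"
  shows "operad_ideal P R \<subseteq> operad_ideal P S"
proof
  fix x assume "x \<in> operad_ideal P R"
  then show "x \<in> operad_ideal P S"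
    by induction (use assms in \<open>auto intro: operad_ideal.intros\<close>)
qed


section \<open>Grafting of trees and the free operad\<close>

lemma length_graft_list [simp]: "length (graft_list ts i u) = length ts"
  by (induction ts arbitrary: i) auto

lemma wf_graft:
  "wf_tree E t \<Longrightarrow> wf_tree E u \<Longrightarrow> wf_tree E (graft t i u)"
  "(\<forall>t\<in>set ts. wf_tree E t) \<Longrightarrow> wf_tree E u \<Longrightarrow> \<forall>t\<in>set (graft_list ts i u). wf_tree E t"
  by (induction t i u and ts i u rule: graft_graft_list.induct) auto

lemma leaves_graft:
  "1 \<le> i \<Longrightarrow> i \<le> leaves t \<Longrightarrow> leaves (graft t i u) = leaves t + leaves u - 1"
  "1 \<le> i \<Longrightarrow> i \<le> sum_list (map leaves ts) \<Longrightarrow>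
    sum_list (map leaves (graft_list ts i u)) = sum_list (map leaves ts) + leaves u - 1"
  by (induction t i u and ts i u rule: graft_graft_list.induct) auto

lemma weight_graft:
  "1 \<le> i \<Longrightarrow> i \<le> leaves t \<Longrightarrow> weight (graft t i u) = weight t + weight u"
  "1 \<le> i \<Longrightarrow> i \<le> sum_list (map leaves ts) \<Longrightarrow>
    sum_list (map weight (graft_list ts i u)) = sum_list (map weight ts) + weight u"
  by (induction t i u and ts i u rule: graft_graft_list.induct) auto

lemma tdeg_graft:
  "1 \<le> i \<Longrightarrow> i \<le> leaves t \<Longrightarrow> tdeg E (graft t i u) = tdeg E t + tdeg E u"
  "1 \<le> i \<Longrightarrow> i \<le> sum_list (map leaves ts) \<Longrightarrow>
    sum_list (map (tdeg E) (graft_list ts i u)) = sum_list (map (tdeg E) ts) + tdeg E u"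
  by (induction t i u and ts i u rule: graft_graft_list.induct) auto

lemma graft_Leaf:
  fixes t :: "'g ptree" and ts :: "'g ptree list"
  shows "graft t i Leaf = t" "graft_list ts i Leaf = ts"
proof -
  have "u = Leaf \<Longrightarrow> graft t i u = t" "u = Leaf \<Longrightarrow> graft_list ts i u = ts" for u :: "'g ptree"
    by (induction t i u and ts i u rule: graft_graft_list.induct) auto
  then show "graft t i Leaf = t" "graft_list ts i Leaf = ts" by auto
qed

text \<open>The vertices after the chosen leaf of the composite are those of \<open>u\<close> after
  its leaf \<open>j\<close> and those of \<open>t\<close> after its leaf \<open>i\<close>. The sign
  exponent is proved together with the tree identity because both follow the same recursion.\<close>

lemma graft_nested:
  "1 \<le> i \<Longrightarrow> i \<le> leaves t \<Longrightarrow> 1 \<le> j \<Longrightarrow> j \<le> leaves u \<Longrightarrow>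
    graft (graft t i u) (i - 1 + j) v = graft t i (graft u j v) \<and>
    deg_after E (graft t i u) (i - 1 + j) = deg_after E t i + deg_after E u j"
  "1 \<le> i \<Longrightarrow> i \<le> sum_list (map leaves ts) \<Longrightarrow> 1 \<le> j \<Longrightarrow> j \<le> leaves u \<Longrightarrow>
    graft_list (graft_list ts i u) (i - 1 + j) v = graft_list ts i (graft u j v) \<and>
    deg_after_list E (graft_list ts i u) (i - 1 + j) = deg_after_list E ts i + deg_after E u j"
  by (induction t i u and ts i u rule: graft_graft_list.induct) (auto simp: leaves_graft)

text \<open>Grafting \<open>u\<close> to the left of leaf \<open>k\<close> shifts that leaf to
  \<open>k - 1 + leaves u\<close> and leaves the vertices after it unchanged. Grafting
  \<open>v\<close> at \<open>k\<close> puts the vertices of \<open>v\<close> after leaf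
  \<open>i\<close>. This asymmetry produces the Koszul sign of parallel composition.\<close>

lemma graft_parallel:
  "1 \<le> i \<Longrightarrow> i < k \<Longrightarrow> k \<le> leaves t \<Longrightarrow>
    graft (graft t i u) (k - 1 + leaves u) v = graft (graft t k v) i u \<and>
    deg_after E (graft t i u) (k - 1 + leaves u) = deg_after E t k \<and>
    deg_after E (graft t k v) i = deg_after E t i + tdeg E v"
  "1 \<le> i \<Longrightarrow> i < k \<Longrightarrow> k \<le> sum_list (map leaves ts) \<Longrightarrow>
    graft_list (graft_list ts i u) (k - 1 + leaves u) v = graft_list (graft_list ts k v) i u \<and>
    deg_after_list E (graft_list ts i u) (k - 1 + leaves u) = deg_after_list E ts k \<and>
    deg_after_list E (graft_list ts k v) i = deg_after_list E ts i + tdeg E v"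
proof (induction t i u and ts i u arbitrary: k and k rule: graft_graft_list.induct)
  case (4 t ts i u)
  \<comment> \<open>Both leaves in the first subtree, separated by its right end, or both in later
    subtrees; the recursion is needed in the outer two cases.\<close>
  consider "k \<le> leaves t" | "i \<le> leaves t" "leaves t < k" | "leaves t < i"
    by linarith
  then show ?case
  proof cases
    case 1
    then have "i \<le> leaves t" "k - 1 + leaves u \<le> leaves t + leaves u - 1"
      "i \<le> leaves t + leaves v - 1"
      using 4 by auto
    then show ?thesis
      using 4(1)[of k] 1 4(3,4) by (simp add: leaves_graft tdeg_graft)
  next
    case 2
    have [simp]: "\<not> k + leaves u - Suc 0 \<le> leaves t + leaves u - Suc 0"
      "k + leaves u - Suc 0 - (leaves t + leaves u - Suc 0) = k - leaves t"
      "\<not> k - Suc 0 + leaves u \<le> leaves t + leaves u - Suc 0"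
      "k - Suc 0 + leaves u - (leaves t + leaves u - Suc 0) = k - leaves t"
      using 2 4 by auto
    show ?thesis
      using 2 4(3-5) by (simp add: leaves_graft tdeg_graft)
  next
    case 3
    have [simp]: "\<not> k - Suc 0 + leaves u \<le> leaves t" "\<not> k + leaves u - Suc 0 \<le> leaves t"
      "\<not> k \<le> leaves t" "\<not> i \<le> leaves t"
      "k + leaves u - Suc 0 - leaves t = (k - leaves t) - Suc 0 + leaves u"
      "k - Suc 0 + leaves u - leaves t = (k - leaves t) - Suc 0 + leaves u"
      using 3 4 by auto
    show ?thesis
      using 3 4(2)[of "k - leaves t"] 4(3-5) by simp
  qed
qed auto

definition tree_basis :: "'g collection \<Rightarrow> nat \<Rightarrow> int \<Rightarrow> 'g ptree set" where
  "tree_basis E n d = {t. wf_tree E t \<and> leaves t = n \<and> tdeg E t = d}"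

definition tree_comp :: "'g collection \<Rightarrow> nat \<Rightarrow> 'g ptree \<Rightarrow> 'g ptree \<Rightarrow> 'g ptree \<Rightarrow>\<^sub>0 'k::field" where
  "tree_comp E i t u = (if 1 \<le> i \<and> i \<le> leaves t
     then Poly_Mapping.single (graft t i u) (koszul (deg_after E t i) (tdeg E u)) else 0)"

interpretation free: based_operad "free_operad E" "tree_basis E" "tree_comp E"
  for E :: "'g collection"
proof
  show "homog (free_operad E) n d = {x. Poly_Mapping.keys x \<subseteq> tree_basis E n d}" for n d
    by (auto simp: free_operad_def tree_basis_def)
  show "pcomp (free_operad E) x i y = bilin (tree_comp E i) x y" for x i y
    by (simp add: free_operad_def tree_comp_def[abs_def])
  show "Poly_Mapping.keys (tree_comp E i t u) \<subseteq> tree_basis E (m + n - 1) (d + e)"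
    if "t \<in> tree_basis E m d" "u \<in> tree_basis E n e" "1 \<le> i" "i \<le> m" for t u m n d e i
    using that by (auto simp: tree_comp_def tree_basis_def wf_graft leaves_graft tdeg_graft)
qed (auto simp: free_operad_def tree_comp_def tree_basis_def)

lemma free_ident: "ident (free_operad E) = Poly_Mapping.single Leaf 1"
  by (simp add: free_operad_def)

lemma free_pcomp_single:
  "1 \<le> i \<Longrightarrow> i \<le> leaves t \<Longrightarrow>
    pcomp (free_operad E) (Poly_Mapping.single t a) i (Poly_Mapping.single u b)
    = Poly_Mapping.single (graft t i u) (a * b * koszul (deg_after E t i) (tdeg E u))"
  by (simp add: free.pcomp tree_comp_def)

lemma ns_operad_free: "ns_operad (free_operad E :: ('k::field, 'g ptree \<Rightarrow>\<^sub>0 'k) operad)"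
proof -
  let ?P = "free_operad E :: ('k, 'g ptree \<Rightarrow>\<^sub>0 'k) operad"
  have "unital_comp ?P"
    by (rule free.unital_compI)
      (auto simp: free_ident free.homog tree_basis_def free_pcomp_single graft_Leaf)
  moreover have "associative_comp ?P"
  proof (rule free.associative_compI)
    fix l a m b n c i j and t u v :: "'g ptree"
    assume "t \<in> tree_basis E l a" "u \<in> tree_basis E m b" "v \<in> tree_basis E n c"
      "1 \<le> i" "i \<le> l" "1 \<le> j" "j \<le> m"
    then show "pcomp ?P (pcomp ?P (Poly_Mapping.single t 1) i (Poly_Mapping.single u 1)) (i - 1 + j) (Poly_Mapping.single v 1)
      = pcomp ?P (Poly_Mapping.single t 1) i (pcomp ?P (Poly_Mapping.single u 1) j (Poly_Mapping.single v 1))"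
      using graft_nested(1)[of i t j u v E]
      by (simp add: tree_basis_def free_pcomp_single leaves_graft tdeg_graft koszul_add_left
          koszul_add_right mult_ac)
  next
    fix l a m b n c i k and t u v :: "'g ptree"
    assume "t \<in> tree_basis E l a" "u \<in> tree_basis E m b" "v \<in> tree_basis E n c"
      "1 \<le> i" "i < k" "k \<le> l"
    moreover from this have "k - 1 + m \<le> l + m - 1" "i \<le> l + n - 1" "1 \<le> k" "i \<le> l" "1 \<le> k - 1 + m"
      by auto
    ultimately show "pcomp ?P (pcomp ?P (Poly_Mapping.single t 1) i (Poly_Mapping.single u 1)) (k - 1 + m) (Poly_Mapping.single v 1)
      = scale (koszul b c) (pcomp ?P (pcomp ?P (Poly_Mapping.single t 1) k (Poly_Mapping.single v 1)) i (Poly_Mapping.single u 1))"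
      using graft_parallel(1)[of i k t u v E]
      by (auto simp: tree_basis_def free_pcomp_single leaves_graft tdeg_graft koszul_add_left
          koszul_commute[of "tdeg E u"] mult_ac)
  qed
  ultimately show ?thesis
    by (simp add: ns_operad_def free.graded_space free.bilinear_comp)
qed

lemma free_pcomp_ident:
  assumes "x \<in> homog (free_operad E) n d"
  shows "pcomp (free_operad E) (ident (free_operad E)) 1 x = x"
    and "1 \<le> i \<Longrightarrow> i \<le> n \<Longrightarrow> pcomp (free_operad E) x i (ident (free_operad E)) = x"
  using ns_operad_free[of E] assms unfolding ns_operad_def unital_comp_def by blast+


section \<open>The weight two part of an ideal\<close>

text \<open>The sign-free bilinear form for which the basis elements are orthonormal; through it
  \<open>y\<close> is read as a functional.\<close>

definition dot :: "('b \<Rightarrow>\<^sub>0 'k) \<Rightarrow> ('b \<Rightarrow>\<^sub>0 'k) \<Rightarrow> 'k::field" where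
  "dot y x = (\<Sum>t\<in>Poly_Mapping.keys x. Poly_Mapping.lookup y t * Poly_Mapping.lookup x t)"

lemma dot_superset:
  "finite S \<Longrightarrow> Poly_Mapping.keys x \<subseteq> S \<Longrightarrow>
    dot y x = (\<Sum>t\<in>S. Poly_Mapping.lookup y t * Poly_Mapping.lookup x t)"
  unfolding dot_def by (rule sum.mono_neutral_left) (auto simp: in_keys_iff)

lemma dot_zero [simp]: "dot y 0 = 0" "dot 0 x = 0"
  by (simp_all add: dot_def)

lemma dot_add [simp]: "dot y (x + x') = dot y x + dot y x'"
  by (simp add: dot_superset[of "Poly_Mapping.keys x \<union> Poly_Mapping.keys x'"] Poly_Mapping.keys_add
      lookup_add distrib_left sum.distrib)

lemma dot_scale [simp]: "dot y (scale c x) = c * dot y x"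
  by (simp add: dot_superset[of "Poly_Mapping.keys x"] keys_scale sum_distrib_left mult_ac)

lemma dot_diff [simp]: "dot y (x - x') = dot y x - dot y x'"
  using dot_add[of y "x - x'" x'] by simp

lemma dot_sum: "dot y (\<Sum>i\<in>S. g i) = (\<Sum>i\<in>S. dot y (g i))"
  by (induction S rule: infinite_finite_induct) auto

lemma dot_single [simp]: "dot y (Poly_Mapping.single t c) = Poly_Mapping.lookup y t * c"
  by (simp add: dot_superset[of "{t}"])

lemma dot_cong:
  assumes "\<And>t. t \<in> Poly_Mapping.keys y \<Longrightarrow> Poly_Mapping.lookup x t = Poly_Mapping.lookup x' t"
  shows "dot y x = dot y x'"
proof -
  let ?S = "Poly_Mapping.keys x \<union> Poly_Mapping.keys x'"
  have "Poly_Mapping.lookup y t * Poly_Mapping.lookup x t = Poly_Mapping.lookup y t * Poly_Mapping.lookup x' t" for t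
    using assms[of t] by (cases "t \<in> Poly_Mapping.keys y") (auto simp: in_keys_iff)
  then show ?thesis
    by (simp only: dot_superset[of ?S] finite_Un finite_keys Un_upper1 Un_upper2 simp_thms)
qed

definition weight_ge_2 :: "('g ptree \<Rightarrow>\<^sub>0 'k::field) \<Rightarrow> bool" where
  "weight_ge_2 x \<longleftrightarrow> (\<forall>t\<in>Poly_Mapping.keys x. 2 \<le> weight t)"

lemma weight_eq_0 [simp]: "weight t = 0 \<longleftrightarrow> t = Leaf"
  by (cases t) auto

lemma weight_pos [simp]: "0 < weight t \<longleftrightarrow> t \<noteq> Leaf"
  by (cases t) auto

lemma keys_pcomp_weight:
  assumes "\<And>t. t \<in> Poly_Mapping.keys x \<Longrightarrow> p \<le> weight t" "\<And>t. t \<in> Poly_Mapping.keys z \<Longrightarrow> q \<le> weight t"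
    and "s \<in> Poly_Mapping.keys (pcomp (free_operad E) x i z)"
  shows "p + q \<le> weight s"
proof -
  have "Poly_Mapping.keys (pcomp (free_operad E) x i z) \<subseteq> {s. p + q \<le> weight s}"
    unfolding free.pcomp using assms(1,2)
    by (intro keys_bilin) (auto simp: tree_comp_def weight_graft add_mono)
  then show ?thesis
    using assms(3) by blast
qed

text \<open>A tree of \<open>z\<close> other than \<open>Leaf\<close> pushes the composite to weight
  at least three, so weight two only sees the multiple of the identity in \<open>z\<close>.\<close>

lemma lookup_pcomp_weight_2_left:
  assumes "x \<in> homog (free_operad E) m d" "weight_ge_2 x" "1 \<le> i" "i \<le> m" "weight t = 2"
  shows "Poly_Mapping.lookup (pcomp (free_operad E) x i z) t
    = Poly_Mapping.lookup z Leaf * Poly_Mapping.lookup x t"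
proof -
  have "Poly_Mapping.keys z \<subseteq> UNIV" by simp
  then show ?thesis
  proof (induction rule: keys_induct)
    case (single_add u c z)
    have "Poly_Mapping.lookup (pcomp (free_operad E) x i (Poly_Mapping.single u c)) t
      = Poly_Mapping.lookup (Poly_Mapping.single u c) Leaf * Poly_Mapping.lookup x t"
    proof (cases "u = Leaf")
      case True
      have "pcomp (free_operad E) x i (Poly_Mapping.single u c)
        = scale c (pcomp (free_operad E) x i (ident (free_operad E)))"
        unfolding free.pcomp bilin_scale_right[symmetric] free_ident True by simp
      then show ?thesis
        using free_pcomp_ident(2)[OF assms(1)] assms(3,4) True by simp
    next
      case False
      then have wu: "1 \<le> weight v" if "v \<in> Poly_Mapping.keys (Poly_Mapping.single u c)" for v
        using that by (simp add: Suc_le_eq split: if_splits)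
      then have "3 \<le> weight s" if "s \<in> Poly_Mapping.keys (pcomp (free_operad E) x i (Poly_Mapping.single u c))" for s
        using keys_pcomp_weight[OF _ wu that, of 2] assms(2) by (simp add: weight_ge_2_def)
      with assms(5) have "t \<notin> Poly_Mapping.keys (pcomp (free_operad E) x i (Poly_Mapping.single u c))"
        by force
      then show ?thesis
        using False by (simp add: in_keys_iff lookup_single)
    qed
    then show ?case
      using single_add by (simp add: free.pcomp bilin_add_right lookup_add algebra_simps)
  qed (simp add: free.pcomp)
qed

lemma lookup_pcomp_weight_2_right:
  assumes "x \<in> homog (free_operad E) n d" "weight_ge_2 x" "z \<in> homog (free_operad E) m e"
    "1 \<le> i" "i \<le> m" "weight t = 2"
  shows "Poly_Mapping.lookup (pcomp (free_operad E) z i x) t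
    = Poly_Mapping.lookup z Leaf * Poly_Mapping.lookup x t"
proof -
  have "Poly_Mapping.keys z \<subseteq> tree_basis E m e"
    using assms(3) by (simp add: free.homog)
  then show ?thesis
  proof (induction rule: keys_induct)
    case (single_add u c z)
    have "Poly_Mapping.lookup (pcomp (free_operad E) (Poly_Mapping.single u c) i x) t
      = Poly_Mapping.lookup (Poly_Mapping.single u c) Leaf * Poly_Mapping.lookup x t"
    proof (cases "u = Leaf")
      case True
      \<comment> \<open>Homogeneity of \<open>z\<close> enters here: if \<open>Leaf\<close> belongs
        to the basis in arity \<open>m\<close>, then \<open>m = 1\<close>.\<close>
      then have "i = 1"
        using single_add(1) assms(4,5) by (simp add: tree_basis_def)
      have "pcomp (free_operad E) (Poly_Mapping.single u c) i x
        = scale c (pcomp (free_operad E) (ident (free_operad E)) 1 x)"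
        unfolding free.pcomp bilin_scale_left[symmetric] free_ident True \<open>i = 1\<close> by simp
      then show ?thesis
        using free_pcomp_ident(1)[OF assms(1)] True by simp
    next
      case False
      then have wu: "1 \<le> weight v" if "v \<in> Poly_Mapping.keys (Poly_Mapping.single u c)" for v
        using that by (simp add: Suc_le_eq split: if_splits)
      then have "3 \<le> weight s" if "s \<in> Poly_Mapping.keys (pcomp (free_operad E) (Poly_Mapping.single u c) i x)" for s
        using keys_pcomp_weight[OF wu _ that, of 2] assms(2) by (simp add: weight_ge_2_def)
      with assms(6) have "t \<notin> Poly_Mapping.keys (pcomp (free_operad E) (Poly_Mapping.single u c) i x)"
        by force
      then show ?thesis
        using False by (simp add: in_keys_iff lookup_single)
    qed
    then show ?case
      using single_add by (simp add: free.pcomp bilin_add_left lookup_add algebra_simps)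
  qed (simp add: free.pcomp)
qed

text \<open>Composing an element of weight at least two with a non-identity tree raises its weight, so in
  weight two the ideal is just the span of the relations.\<close>

lemma dot_ideal:
  assumes R: "\<And>r. r \<in> R \<Longrightarrow> weight_ge_2 r" "\<And>r. r \<in> R \<Longrightarrow> dot y r = 0"
    and y: "\<And>t. t \<in> Poly_Mapping.keys y \<Longrightarrow> weight t = 2"
    and "x \<in> operad_ideal (free_operad E) R"
  shows "dot y x = 0"
proof -
  have "weight_ge_2 x \<and> dot y x = 0"
    using assms(4)
  proof induction
    case (add x z)
    then show ?case
      using Poly_Mapping.keys_add[of x z] by (auto simp: weight_ge_2_def)
  next
    case (smul x c)
    then show ?case
      using keys_scale[of c x] by (auto simp: weight_ge_2_def)
  next
    case (comp_left x m d z n e i)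
    have "dot y (pcomp (free_operad E) x i z) = dot y (scale (Poly_Mapping.lookup z Leaf) x)"
      by (rule dot_cong) (use comp_left y in \<open>simp add: lookup_pcomp_weight_2_left\<close>)
    moreover have "weight_ge_2 (pcomp (free_operad E) x i z)"
      using keys_pcomp_weight[of x 2 z 0 _ E i] comp_left by (auto simp: weight_ge_2_def)
    ultimately show ?case
      using comp_left by simp
  next
    case (comp_right x n e z m d i)
    have "dot y (pcomp (free_operad E) z i x) = dot y (scale (Poly_Mapping.lookup z Leaf) x)"
      by (rule dot_cong) (use comp_right y in \<open>simp add: lookup_pcomp_weight_2_right\<close>)
    moreover have "weight_ge_2 (pcomp (free_operad E) z i x)"
      using keys_pcomp_weight[of z 0 x 2 _ E i] comp_right by (auto simp: weight_ge_2_def numeral_2_eq_2)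
    ultimately show ?case
      using comp_right by simp
  qed (use R in \<open>auto simp: weight_ge_2_def\<close>)
  then show ?thesis ..
qed


section \<open>Hadamard products and suspensions\<close>

definition tensor_basis ::
  "('k::field, 'a) operad \<Rightarrow> ('k, 'b) operad \<Rightarrow> nat \<Rightarrow> int \<Rightarrow> ('a, 'b) ftensor set" where
  "tensor_basis P Q n d = {(n', a, p, b, q). n' = n \<and> a + b = d \<and> p \<in> homog P n a \<and> q \<in> homog Q n b}"

definition tensor_comp ::
  "('k::field, 'a) operad \<Rightarrow> ('k, 'b) operad \<Rightarrow> nat \<Rightarrow> ('a, 'b) ftensor \<Rightarrow> ('a, 'b) ftensor
    \<Rightarrow> ('a, 'b) ftensor \<Rightarrow>\<^sub>0 'k" where
  "tensor_comp P Q i = (\<lambda>(m, a, p, b, q) (n, a', p', b', q'). if 1 \<le> i \<and> i \<le> m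
     then Poly_Mapping.single (m + n - 1, a + a', pcomp P p i p', b + b', pcomp Q q i q') (koszul b a')
     else 0)"

locale hadamard_pair =
  fixes P :: "('k::field, 'a) operad" and Q :: "('k, 'b) operad"
  assumes graded_P: "graded_space P" and graded_Q: "graded_space Q"
    and bilinear_P: "bilinear_comp P" and bilinear_Q: "bilinear_comp Q"
begin

lemma pcomp_P:
  assumes "x \<in> homog P m d" "y \<in> homog P n e" "1 \<le> i" "i \<le> m"
  shows "pcomp P x i y \<in> homog P (m + n - 1) (d + e)"
    and "pcomp P (smul P c x) i y = smul P c (pcomp P x i y)"
    and "pcomp P x i (smul P c y) = smul P c (pcomp P x i y)"
    and "x' \<in> homog P m d \<Longrightarrow> pcomp P (add P x x') i y = add P (pcomp P x i y) (pcomp P x' i y)"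
    and "y' \<in> homog P n e \<Longrightarrow> pcomp P x i (add P y y') = add P (pcomp P x i y) (pcomp P x i y')"
  using bilinear_P assms unfolding bilinear_comp_def by blast+

lemma pcomp_Q:
  assumes "x \<in> homog Q m d" "y \<in> homog Q n e" "1 \<le> i" "i \<le> m"
  shows "pcomp Q x i y \<in> homog Q (m + n - 1) (d + e)"
    and "pcomp Q (smul Q c x) i y = smul Q c (pcomp Q x i y)"
    and "pcomp Q x i (smul Q c y) = smul Q c (pcomp Q x i y)"
    and "x' \<in> homog Q m d \<Longrightarrow> pcomp Q (add Q x x') i y = add Q (pcomp Q x i y) (pcomp Q x' i y)"
    and "y' \<in> homog Q n e \<Longrightarrow> pcomp Q x i (add Q y y') = add Q (pcomp Q x i y) (pcomp Q x i y')"
  using bilinear_Q assms unfolding bilinear_comp_def by blast+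

lemma closed_P:
  "x \<in> homog P n d \<Longrightarrow> smul P c x \<in> homog P n d"
  "x \<in> homog P n d \<Longrightarrow> y \<in> homog P n d \<Longrightarrow> add P x y \<in> homog P n d"
  using graded_P unfolding graded_space_def by blast+

lemma closed_Q:
  "x \<in> homog Q n d \<Longrightarrow> smul Q c x \<in> homog Q n d"
  "x \<in> homog Q n d \<Longrightarrow> y \<in> homog Q n d \<Longrightarrow> add Q x y \<in> homog Q n d"
  using graded_Q unfolding graded_space_def by blast+

sublocale tensor_based: based_operad "tensor_free P Q" "tensor_basis P Q" "tensor_comp P Q"
proof
  show "homog (tensor_free P Q) n d = {x. Poly_Mapping.keys x \<subseteq> tensor_basis P Q n d}" for n d
    by (auto simp: tensor_free_def tensor_basis_def)
  show "Poly_Mapping.keys (tensor_comp P Q i t u) \<subseteq> tensor_basis P Q (m + n - 1) (d + e)"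
    if "t \<in> tensor_basis P Q m d" "u \<in> tensor_basis P Q n e" "1 \<le> i" "i \<le> m" for t u m n d e i
    using that by (auto simp: tensor_comp_def tensor_basis_def pcomp_P(1)[unfolded One_nat_def]
        pcomp_Q(1)[unfolded One_nat_def] split: if_splits)
qed (auto simp: tensor_free_def tensor_comp_def tensor_basis_def)

lemma pcomp_single:
  "pcomp (tensor_free P Q) (Poly_Mapping.single (m, a, p, b, q) c) i
     (Poly_Mapping.single (n, a', p', b', q') c') =
   (if 1 \<le> i \<and> i \<le> m then Poly_Mapping.single
      (m + n - 1, a + a', pcomp P p i p', b + b', pcomp Q q i q') (c * c' * koszul b a') else 0)"
  by (simp add: tensor_based.pcomp tensor_comp_def)

text \<open>Composing a generating tensor relation with a formal tensor gives a relation of the same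
  kind times a Koszul sign, hence the free coefficient \<open>c\<close>.\<close>

lemma tensor_rels_scaled:
  "p \<in> homog P n a \<Longrightarrow> p' \<in> homog P n a \<Longrightarrow> q \<in> homog Q n b \<Longrightarrow>
    Poly_Mapping.single (n, a, add P p p', b, q) c
      - Poly_Mapping.single (n, a, p, b, q) c - Poly_Mapping.single (n, a, p', b, q) c \<in> tensor_rels P Q"
  "p \<in> homog P n a \<Longrightarrow> q \<in> homog Q n b \<Longrightarrow> q' \<in> homog Q n b \<Longrightarrow>
    Poly_Mapping.single (n, a, p, b, add Q q q') c
      - Poly_Mapping.single (n, a, p, b, q) c - Poly_Mapping.single (n, a, p, b, q') c \<in> tensor_rels P Q"
  "p \<in> homog P n a \<Longrightarrow> q \<in> homog Q n b \<Longrightarrow>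
    Poly_Mapping.single (n, a, smul P e p, b, q) c - Poly_Mapping.single (n, a, p, b, q) (c * e)
    \<in> tensor_rels P Q"
  "p \<in> homog P n a \<Longrightarrow> q \<in> homog Q n b \<Longrightarrow>
    Poly_Mapping.single (n, a, p, b, smul Q e q) c - Poly_Mapping.single (n, a, p, b, q) (c * e)
    \<in> tensor_rels P Q"
  using tensor_rels.smul[OF tensor_rels.add_left, of p P n a p' q Q b c]
    tensor_rels.smul[OF tensor_rels.add_right, of p P n a q Q b q' c]
    tensor_rels.smul[OF tensor_rels.smul_left, of p P n a q Q b c e]
    tensor_rels.smul[OF tensor_rels.smul_right, of p P n a q Q b c e]
  by (simp_all add: scale_diff)

text \<open>Bilinearity of composition in \<open>P\<close> and \<open>Q\<close> turns each kind of
  generating relation into a scaled one of the same kind, with the composed entries in place of the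
  old ones.\<close>

sublocale had: operad_congruence "tensor_free P Q" "tensor_basis P Q" "tensor_comp P Q" "tensor_rels P Q"
proof
  let ?T = "tensor_free P Q" and ?I = "tensor_rels P Q"
  show "0 \<in> ?I" "\<And>x y. x \<in> ?I \<Longrightarrow> y \<in> ?I \<Longrightarrow> x + y \<in> ?I" "\<And>x c. x \<in> ?I \<Longrightarrow> scale c x \<in> ?I"
    by (auto intro: tensor_rels.intros)
  fix x assume x: "x \<in> ?I"
  have diff: "Poly_Mapping.keys (y - z) \<subseteq> S" if "Poly_Mapping.keys y \<subseteq> S" "Poly_Mapping.keys z \<subseteq> S"
    for y z :: "('a, 'b) ftensor \<Rightarrow>\<^sub>0 'k" and S
    using that Poly_Mapping.keys_diff[of y z] by blast
  have basis: "(n, a, p, b, q) \<in> tensor_based.basis" if "p \<in> homog P n a" "q \<in> homog Q n b" for n a p b q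
    using that unfolding tensor_based.basis_def tensor_basis_def by blast
  show "Poly_Mapping.keys x \<subseteq> tensor_based.basis"
    using x
  proof induction
    case (add x y)
    then show ?case using Poly_Mapping.keys_add[of x y] by blast
  next
    case (smul x c)
    then show ?case using keys_scale[of c x] by blast
  qed ((intro diff)?; simp add: basis closed_P closed_Q)+
  fix t i assume "t \<in> tensor_based.basis"
  then obtain n' a' p' b' q' where t: "t = (n', a', p', b', q')" "p' \<in> homog P n' a'" "q' \<in> homog Q n' b'"
    unfolding tensor_based.basis_def tensor_basis_def by auto
  note lin = tensor_based.pcomp_linear
    and comp = pcomp_P pcomp_Q pcomp_P(1)[unfolded One_nat_def] pcomp_Q(1)[unfolded One_nat_def]
  show "pcomp ?T x i (Poly_Mapping.single t 1) \<in> ?I"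
    using x
  proof induction
    case (add_left p n a p1 q b)
    then show ?case
      using tensor_rels_scaled(1)[of "pcomp P p i p'" "n + n' - 1" "a + a'" "pcomp P p1 i p'"
          "pcomp Q q i q'" "b + b'" "koszul b a'"] t(2,3)
      by (simp add: t(1) lin pcomp_single comp tensor_rels.zero)
  next
    case (add_right p n a q b q1)
    then show ?case
      using tensor_rels_scaled(2)[of "pcomp P p i p'" "n + n' - 1" "a + a'" "pcomp Q q i q'" "b + b'"
          "pcomp Q q1 i q'" "koszul b a'"] t(2,3)
      by (simp add: t(1) lin pcomp_single comp tensor_rels.zero)
  next
    case (smul_left p n a q b c)
    then show ?case
      using tensor_rels_scaled(3)[of "pcomp P p i p'" "n + n' - 1" "a + a'" "pcomp Q q i q'" "b + b'"
          c "koszul b a'"] t(2,3)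
      by (simp add: t(1) lin pcomp_single comp tensor_rels.zero mult.commute)
  next
    case (smul_right p n a q b c)
    then show ?case
      using tensor_rels_scaled(4)[of "pcomp P p i p'" "n + n' - 1" "a + a'" "pcomp Q q i q'" "b + b'"
          c "koszul b a'"] t(2,3)
      by (simp add: t(1) lin pcomp_single comp tensor_rels.zero mult.commute)
  qed (auto simp: lin intro: tensor_rels.intros)
  show "pcomp ?T (Poly_Mapping.single t 1) i x \<in> ?I"
    using x
  proof induction
    case (add_left p n a p1 q b)
    then show ?case
      using tensor_rels_scaled(1)[of "pcomp P p' i p" "n' + n - 1" "a' + a" "pcomp P p' i p1"
          "pcomp Q q' i q" "b' + b" "koszul b' a"] t(2,3)
      by (simp add: t(1) lin pcomp_single comp tensor_rels.zero)
  next
    case (add_right p n a q b q1)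
    then show ?case
      using tensor_rels_scaled(2)[of "pcomp P p' i p" "n' + n - 1" "a' + a" "pcomp Q q' i q" "b' + b"
          "pcomp Q q' i q1" "koszul b' a"] t(2,3)
      by (simp add: t(1) lin pcomp_single comp tensor_rels.zero)
  next
    case (smul_left p n a q b c)
    then show ?case
      using tensor_rels_scaled(3)[of "pcomp P p' i p" "n' + n - 1" "a' + a" "pcomp Q q' i q" "b' + b"
          c "koszul b' a"] t(2,3)
      by (simp add: t(1) lin pcomp_single comp tensor_rels.zero mult.commute)
  next
    case (smul_right p n a q b c)
    then show ?case
      using tensor_rels_scaled(4)[of "pcomp P p' i p" "n' + n - 1" "a' + a" "pcomp Q q' i q" "b' + b"
          c "koszul b' a"] t(2,3)
      by (simp add: t(1) lin pcomp_single comp tensor_rels.zero mult.commute)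
  qed (auto simp: lin intro: tensor_rels.intros)
qed

end

section \<open>The endomorphism operad of a graded line\<close>

definition line_basis :: "int \<Rightarrow> nat \<Rightarrow> int \<Rightarrow> nat set" where
  "line_basis e n d = {m. m = n \<and> d = end_deg e n}"

definition line_comp :: "int \<Rightarrow> nat \<Rightarrow> nat \<Rightarrow> nat \<Rightarrow> nat \<Rightarrow>\<^sub>0 'k::field" where
  "line_comp e i = (\<lambda>m n. if 1 \<le> i \<and> i \<le> m
     then Poly_Mapping.single (m + n - 1) (end_sign e i n) else 0)"

interpretation line: based_operad "end_line e" "line_basis e" "line_comp e" for e
proof
  show "homog (end_line e) n d = {x. Poly_Mapping.keys x \<subseteq> line_basis e n d}" for n d
    by (auto simp: end_line_def line_basis_def)
  have "end_deg e m + end_deg e n = end_deg e (m + n - 1)" if "1 \<le> m" for m n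
    using that by (simp add: end_deg_def of_nat_diff algebra_simps)
  then show "Poly_Mapping.keys (line_comp e i t u) \<subseteq> line_basis e (m + n - 1) (d + e')"
    if "t \<in> line_basis e m d" "u \<in> line_basis e n e'" "1 \<le> i" "i \<le> m" for t u m n d e' i
    using that by (auto simp: line_comp_def line_basis_def)
qed (auto simp: end_line_def line_comp_def line_basis_def)

abbreviation line_gen :: "nat \<Rightarrow> (nat \<Rightarrow>\<^sub>0 'k::field)" where
  "line_gen n \<equiv> Poly_Mapping.single n 1"

lemma line_gen_homog: "line_gen n \<in> homog (end_line e) n (end_deg e n)"
  by (simp add: line.homog line_basis_def)

text \<open>The sign stays a \<open>smul\<close> on the generator because in this form a
  \<open>smul_left\<close> relation can carry it out of a tensor.\<close>

lemma line_pcomp: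
  "1 \<le> i \<Longrightarrow> i \<le> m \<Longrightarrow>
    pcomp (end_line e) (line_gen m) i (line_gen n) = smul (end_line e) (end_sign e i n) (line_gen (m + n - 1))"
  by (simp add: line.pcomp line_comp_def)

lemma end_deg_add: "1 \<le> m \<Longrightarrow> end_deg e m + end_deg e n = end_deg e (m + n - 1)"
  by (simp add: end_deg_def of_nat_diff algebra_simps)

lemma end_deg_1 [simp]: "end_deg e (Suc 0) = 0"
  by (simp add: end_deg_def)

section \<open>Corollas, their composites and the evaluation of these\<close>

lemma deg_after_list_replicate [simp]: "deg_after_list E (replicate n Leaf) i = 0"
  by (induction n arbitrary: i) (auto simp: sum_list_replicate)

lemma leaves_corolla [simp]: "leaves (corolla E b) = gar E b"
  by (simp add: corolla_def sum_list_replicate)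

lemma tdeg_corolla [simp]: "tdeg E (corolla E b) = gdeg E b"
  by (simp add: corolla_def sum_list_replicate)

lemma wf_corolla [simp]: "wf_tree E (corolla E b) \<longleftrightarrow> b \<in> gset E"
  by (auto simp: corolla_def)

lemma graft_corolla:
  assumes "1 \<le> i" "i \<le> gar E b"
  shows "graft (corolla E b) i u = Node b (replicate (i - 1) Leaf @ u # replicate (gar E b - i) Leaf)"
proof -
  have "graft_list (replicate n Leaf) i u = replicate (i - 1) Leaf @ u # replicate (n - i) Leaf"
    if "1 \<le> i" "i \<le> n" for n
    using that
  proof (induction n arbitrary: i)
    case (Suc n)
    then show ?case
      by (cases i; cases "i - 1") auto
  qed simp
  then show ?thesis
    using assms by (simp add: corolla_def)
qed

text \<open>No vertex of a corolla comes after one of its leaves in preorder, so the composite of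
  two generators carries no sign.\<close>

lemma gen_comp_eq:
  "1 \<le> i \<Longrightarrow> i \<le> gar E b \<Longrightarrow>
    gen_comp E b i c = Poly_Mapping.single (graft (corolla E b) i (corolla E c)) 1"
  by (simp add: gen_comp_def gen_def free_pcomp_single) (simp add: corolla_def)

lemma eval_list_append:
  "eval_list P g x i (ts @ us) = eval_list P g (eval_list P g x i ts) (i + sum_list (map leaves ts)) us"
  by (induction ts arbitrary: x i) (simp_all add: add.assoc)

lemma eval_list_replicate:
  assumes "\<And>j. i \<le> j \<Longrightarrow> j < i + n \<Longrightarrow> pcomp P x j (ident P) = x"
  shows "eval_list P g x i (replicate n Leaf) = x"
  using assms by (induction n arbitrary: i) simp_all

lemma eval_corolla:
  assumes "\<And>j. 1 \<le> j \<Longrightarrow> j \<le> gar E b \<Longrightarrow> pcomp P (g b) j (ident P) = g b"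
  shows "eval_tree P g (corolla E b) = g b"
  unfolding corolla_def using assms by (simp add: eval_list_replicate)

text \<open>All leaves evaluate to composition with the identity. The unit law is assumed just for
  the elements that occur, so that no operad axioms have to be established for the
  suspension.\<close>

lemma eval_graft_corolla:
  assumes "\<And>j. 1 \<le> j \<Longrightarrow> j \<le> gar E b \<Longrightarrow> pcomp P (g b) j (ident P) = g b"
    and "\<And>j. 1 \<le> j \<Longrightarrow> j \<le> gar E c \<Longrightarrow> pcomp P (g c) j (ident P) = g c"
    and "\<And>j. 1 \<le> j \<Longrightarrow> j \<le> gar E b + gar E c - 1 \<Longrightarrow>
      pcomp P (pcomp P (g b) i (g c)) j (ident P) = pcomp P (g b) i (g c)"
    and "1 \<le> i" "i \<le> gar E b"
  shows "eval_tree P g (graft (corolla E b) i (corolla E c)) = pcomp P (g b) i (g c)"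
proof -
  have "eval_list P g (g b) 1 (replicate (i - 1) Leaf) = g b"
    by (rule eval_list_replicate) (use assms in auto)
  moreover have "eval_list P g (pcomp P (g b) i (g c)) (i + gar E c) (replicate (gar E b - i) Leaf)
      = pcomp P (g b) i (g c)"
    by (rule eval_list_replicate) (use assms in auto)
  ultimately show ?thesis
    using assms(4,5) eval_corolla[of E c P g, OF assms(2)]
    by (simp add: graft_corolla eval_list_append sum_list_replicate)
qed


section \<open>Presented operads and evaluation in their suspensions\<close>

locale presentation =
  fixes E :: "'g collection" and R :: "('g ptree \<Rightarrow>\<^sub>0 'k::field) set"
  assumes R_homog: "r \<in> R \<Longrightarrow> \<exists>n d. r \<in> homog (free_operad E) n d"
begin

abbreviation I :: "('g ptree \<Rightarrow>\<^sub>0 'k) set" where "I \<equiv> operad_ideal (free_operad E) R"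
abbreviation Q :: "('k, ('g ptree \<Rightarrow>\<^sub>0 'k) set) operad" where "Q \<equiv> presented_operad E R"

sublocale pres: operad_congruence "free_operad E" "tree_basis E" "tree_comp E" I
  by (rule free.operad_congruence_ideal) (rule R_homog)

lemma ns_operad_Q: "ns_operad Q"
  unfolding presented_operad_def by (rule pres.ns_operad_quot) (rule ns_operad_free)

sublocale susp: hadamard_pair "end_line 1" Q
  using ns_operad_Q by unfold_locales (simp_all add: ns_operad_def line.graded_space line.bilinear_comp)

definition line_tensor :: "nat \<Rightarrow> int \<Rightarrow> ('g ptree \<Rightarrow>\<^sub>0 'k) set \<Rightarrow>
    (nat \<Rightarrow>\<^sub>0 'k, ('g ptree \<Rightarrow>\<^sub>0 'k) set) ftensor" where
  "line_tensor n d q = (n, end_deg 1 n, line_gen n, d, q)"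

lemma suspension_quot: "suspension Q = quot (tensor_free (end_line 1) Q) (tensor_rels (end_line 1) Q)"
  by (simp add: suspension_def hadamard_def)

lemma susp_gen_eq:
  "susp_gen Q E g b = susp.had.cls (Poly_Mapping.single (line_tensor (gar E b) (gdeg E b) (g b)) 1)"
  by (simp add: susp_gen_def tensor_def line_tensor_def)

lemma line_tensor_basis: "q \<in> homog Q n d \<Longrightarrow> line_tensor n d q \<in> susp.tensor_based.basis"
  unfolding susp.tensor_based.basis_def tensor_basis_def line_tensor_def using line_gen_homog by blast

text \<open>\<open>koszul d (end_deg 1 n)\<close> comes from moving the second line generator past
  \<open>q\<close>, and \<open>end_sign 1 i n\<close> from the composition in the line. The
  coefficient \<open>c\<close> lets the rule apply again to a composite that already carries a
  sign.\<close>

lemma suspension_pcomp: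
  assumes q: "q \<in> homog Q m d" "q' \<in> homog Q n e" and i: "1 \<le> i" "i \<le> m"
  shows "pcomp (suspension Q) (susp.had.cls (Poly_Mapping.single (line_tensor m d q) c)) i
      (susp.had.cls (Poly_Mapping.single (line_tensor n e q') 1))
    = susp.had.cls (Poly_Mapping.single (line_tensor (m + n - 1) (d + e) (pcomp Q q i q'))
        (c * (koszul d (end_deg 1 n) * end_sign 1 i n)))"
proof -
  have "pcomp (suspension Q) (susp.had.cls (Poly_Mapping.single (line_tensor m d q) c)) i
      (susp.had.cls (Poly_Mapping.single (line_tensor n e q') 1))
    = susp.had.cls (pcomp (tensor_free (end_line 1) Q) (Poly_Mapping.single (line_tensor m d q) c) i
        (Poly_Mapping.single (line_tensor n e q') 1))"
    unfolding suspension_quot using line_tensor_basis q by (intro susp.had.quot_pcomp) auto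
  also have "\<dots> = susp.had.cls (Poly_Mapping.single
      (m + n - 1, end_deg 1 (m + n - 1), smul (end_line 1) (end_sign 1 i n) (line_gen (m + n - 1)),
       d + e, pcomp Q q i q') (c * koszul d (end_deg 1 n)))"
    using i by (simp add: line_tensor_def susp.pcomp_single line_pcomp end_deg_add del: line.smul)
  also have "\<dots> = susp.had.cls (Poly_Mapping.single (line_tensor (m + n - 1) (d + e) (pcomp Q q i q'))
        (c * koszul d (end_deg 1 n) * end_sign 1 i n))"
    unfolding susp.had.cls_eq_iff line_tensor_def
    by (rule susp.tensor_rels_scaled(3)) (intro line_gen_homog susp.pcomp_Q(1) q i)+
  finally show ?thesis
    by (simp add: mult.assoc)
qed

text \<open>The identity of the line has degree 0, so both signs of \<open>suspension_pcomp\<close>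
  are trivial.\<close>

lemma suspension_pcomp_ident:
  assumes "q \<in> homog Q m d" "1 \<le> i" "i \<le> m"
  shows "pcomp (suspension Q) (susp.had.cls (Poly_Mapping.single (line_tensor m d q) c)) i (ident (suspension Q))
    = susp.had.cls (Poly_Mapping.single (line_tensor m d q) c)"
proof -
  have "unital_comp Q"
    using ns_operad_Q by (simp add: ns_operad_def)
  then have id: "ident Q \<in> homog Q 1 0" "pcomp Q q i (ident Q) = q"
    using assms unfolding unital_comp_def by blast+
  have "ident (suspension Q) = susp.had.cls (Poly_Mapping.single (line_tensor 1 0 (ident Q)) 1)"
    unfolding suspension_quot susp.had.quot_ident by (simp add: tensor_free_def line_tensor_def end_line_def)
  then show ?thesis
    using suspension_pcomp[OF assms(1) id(1) assms(2,3), of c] id(2)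
    by (simp add: end_sign_def)
qed

lemma eval_tree_suspension:
  assumes g: "\<And>b. b \<in> gset E \<Longrightarrow> g b \<in> homog Q (gar E b) (gdeg E b)"
    and "b \<in> gset E" "c \<in> gset E" "1 \<le> i" "i \<le> gar E b"
  shows "eval_tree (suspension Q) (susp_gen Q E g) (graft (corolla E b) i (corolla E c))
    = susp.had.cls (Poly_Mapping.single
        (line_tensor (gar E b + gar E c - 1) (gdeg E b + gdeg E c) (pcomp Q (g b) i (g c)))
        (koszul (gdeg E b) (end_deg 1 (gar E c)) * end_sign 1 i (gar E c)))"
proof -
  have bc: "pcomp Q (g b) i (g c) \<in> homog Q (gar E b + gar E c - 1) (gdeg E b + gdeg E c)"
    using susp.pcomp_Q(1)[OF g g] assms by blast
  have comp: "pcomp (suspension Q) (susp_gen Q E g b) i (susp_gen Q E g c)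
    = susp.had.cls (Poly_Mapping.single
        (line_tensor (gar E b + gar E c - 1) (gdeg E b + gdeg E c) (pcomp Q (g b) i (g c)))
        (koszul (gdeg E b) (end_deg 1 (gar E c)) * end_sign 1 i (gar E c)))"
    unfolding susp_gen_eq using suspension_pcomp[OF g g] assms by simp
  have "pcomp (suspension Q) (susp_gen Q E g b) j (ident (suspension Q)) = susp_gen Q E g b"
    if "b \<in> gset E" "1 \<le> j" "j \<le> gar E b" for b j
    unfolding susp_gen_eq using suspension_pcomp_ident[OF g] that by blast
  moreover have "pcomp (suspension Q) (pcomp (suspension Q) (susp_gen Q E g b) i (susp_gen Q E g c)) j
      (ident (suspension Q)) = pcomp (suspension Q) (susp_gen Q E g b) i (susp_gen Q E g c)"
    if "1 \<le> j" "j \<le> gar E b + gar E c - 1" for j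
    unfolding comp using suspension_pcomp_ident[OF bc that] .
  ultimately show ?thesis
    unfolding comp[symmetric] using assms(2-5) by (intro eval_graft_corolla)
qed

text \<open>The map \<open>\<Phi>\<close> below sends \<open>p \<otimes> q\<close> to the coefficient of \<open>p\<close> at the line generator times a chosen
  representative of the class \<open>q\<close>.  It takes the tensor relations into the ideal, so tensoring with the line
  generator is injective.\<close>

lemma sum_cls_tensor:
  assumes "finite S" "S \<subseteq> tree_basis E n d"
  shows "(\<Sum>t\<in>S. Poly_Mapping.single (line_tensor n d (pres.cls (Poly_Mapping.single t 1))) (c t)) \<in> tensor_rels (end_line 1) Q
    \<longleftrightarrow> (\<Sum>t\<in>S. Poly_Mapping.single t (c t)) \<in> I" (is "?L \<in> _ \<longleftrightarrow> ?R \<in> _")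
proof
  \<comment> \<open>Using \<open>bilin\<close> with a dummy second argument makes linearity
    immediate.\<close>
  define \<Phi> :: "((nat \<Rightarrow>\<^sub>0 'k, ('g ptree \<Rightarrow>\<^sub>0 'k) set) ftensor \<Rightarrow>\<^sub>0 'k) \<Rightarrow> ('g ptree \<Rightarrow>\<^sub>0 'k)" where
    "\<Phi> = (\<lambda>z. bilin (\<lambda>(n, a, p, b, q) _. scale (Poly_Mapping.lookup p n) (SOME y. y \<in> q)) z
       (Poly_Mapping.single undefined 1))"
  have \<Phi>_lin: "\<Phi> 0 = 0" "\<Phi> (x + y) = \<Phi> x + \<Phi> y" "\<Phi> (x - y) = \<Phi> x - \<Phi> y" "\<Phi> (scale e x) = scale e (\<Phi> x)" for x y e
    by (simp_all add: \<Phi>_def bilin_add_left bilin_diff_left bilin_scale_left)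
  have \<Phi>_single: "\<Phi> (Poly_Mapping.single (m, a, p, b, q) e) = scale (e * Poly_Mapping.lookup p m) (SOME y. y \<in> q)" for m a p b q e
    by (simp add: \<Phi>_def)
  have rep: "(SOME y. y \<in> pres.cls x) - x \<in> I" for x
    using someI[of "\<lambda>y. y \<in> pres.cls x", OF pres.mem_self] by (simp add: pres.mem_cls)
  have rels: "\<Phi> z \<in> I" if "z \<in> tensor_rels (end_line 1) Q" for z
    using that
  proof induction
    case (add_right p n a q b q')
    then obtain x x' where x: "q = pres.cls x" "q' = pres.cls x'"
      by (auto simp: presented_operad_def pres.quot_homog)
    define u u' v where "u = (SOME y. y \<in> pres.cls x)" and "u' = (SOME y. y \<in> pres.cls x')"
      and "v = (SOME y. y \<in> pres.cls (x + x'))"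
    \<comment> \<open>The choice of representatives is not additive, but its defect is a combination
      of differences of representatives and hence lies in \<open>I\<close>.\<close>
    have "v - u - u' = (v - (x + x')) - (u - x) - (u' - x')"
      by simp
    also have "\<dots> \<in> I"
      unfolding u_def u'_def v_def by (intro pres.I_diff rep)
    finally have "scale e (v - u - u') \<in> I" for e
      by (rule pres.I_scale)
    then show ?case
      by (simp add: x \<Phi>_lin \<Phi>_single presented_operad_def scale_diff u_def u'_def v_def)
  next
    case (smul_right p n a q b e)
    then obtain x where x: "q = pres.cls x"
      by (auto simp: presented_operad_def pres.quot_homog)
    define u v where "u = (SOME y. y \<in> pres.cls x)" and "v = (SOME y. y \<in> pres.cls (scale e x))"
    have "v - scale e u = (v - scale e x) - scale e (u - x)"
      by (simp add: scale_diff)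
    also have "\<dots> \<in> I"
      unfolding u_def v_def by (intro pres.I_diff pres.I_scale rep)
    finally have "scale (Poly_Mapping.lookup p n) (v - scale e u) \<in> I"
      by (rule pres.I_scale)
    then show ?case
      by (simp add: x \<Phi>_lin \<Phi>_single presented_operad_def scale_diff u_def v_def mult.commute)
  qed (auto simp: \<Phi>_lin \<Phi>_single lookup_add scale_add_left intro: pres.I_add pres.I_scale)
  assume "?L \<in> tensor_rels (end_line 1) Q"
  \<comment> \<open>The chosen representative of the class of \<open>t\<close> need not be
    \<open>t\<close>, so the original sum is recovered only modulo \<open>I\<close>.\<close>
  moreover have "\<Phi> ?L - ?R \<in> I"
    using assms(1)
  proof (induction S rule: finite_induct)
    case (insert t S)
    have "\<Phi> (Poly_Mapping.single (line_tensor n d (pres.cls (Poly_Mapping.single t 1))) (c t)) - Poly_Mapping.single t (c t)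
      = scale (c t) ((SOME y. y \<in> pres.cls (Poly_Mapping.single t 1)) - Poly_Mapping.single t 1)"
      by (simp add: line_tensor_def \<Phi>_single scale_diff)
    also have "\<dots> \<in> I"
      by (intro pres.I_scale rep)
    finally show ?case
      using pres.I_add insert by (fastforce simp: \<Phi>_lin algebra_simps)
  qed (simp add: \<Phi>_lin)
  ultimately show "?R \<in> I"
    using pres.I_diff[OF rels] by fastforce
next
  let ?J = "tensor_rels (end_line 1) Q"
  have cls_homog: "pres.cls x \<in> homog Q n d" if "Poly_Mapping.keys x \<subseteq> tree_basis E n d" for x
    using that by (simp add: presented_operad_def pres.quot_homog free.homog)
  \<comment> \<open>Bilinearity collapses the sum of tensors to one tensor. The claim on keys keeps
    the partial sums homogeneous, as the tensor relations demand.\<close>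
  have "?L - Poly_Mapping.single (line_tensor n d (pres.cls ?R)) 1 \<in> ?J \<and> Poly_Mapping.keys ?R \<subseteq> tree_basis E n d"
    using assms
  proof (induction S rule: finite_induct)
    case empty
    \<comment> \<open>A formal tensor with the zero class is not zero; it becomes a relation through
      \<open>smul_right\<close> with scalar 0.\<close>
    have "Poly_Mapping.single (line_tensor n d (smul Q 0 (pres.cls 0))) (1::'k) \<in> ?J"
      using susp.tensor_rels_scaled(4)[OF line_gen_homog cls_homog[of 0], of 0 1]
      by (simp add: line_tensor_def)
    then show ?case
      using susp.had.I_uminus by (simp add: presented_operad_def)
  next
    case (insert t S)
    let ?s = "Poly_Mapping.single t (1::'k)" and ?R = "\<Sum>t\<in>S. Poly_Mapping.single t (c t)"
    let ?L = "\<Sum>t\<in>S. Poly_Mapping.single (line_tensor n d (pres.cls (Poly_Mapping.single t 1))) (c t)"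
    have R: "?L - Poly_Mapping.single (line_tensor n d (pres.cls ?R)) 1 \<in> ?J" "Poly_Mapping.keys ?R \<subseteq> tree_basis E n d"
      and t: "t \<in> tree_basis E n d"
      using insert by auto
    have A: "Poly_Mapping.single (line_tensor n d (pres.cls (scale (c t) ?s))) 1 - Poly_Mapping.single (line_tensor n d (pres.cls ?s)) (c t) \<in> ?J"
      using susp.tensor_rels_scaled(4)[OF line_gen_homog cls_homog[of ?s], of "c t" 1] t
      by (simp add: line_tensor_def presented_operad_def)
    have B: "Poly_Mapping.single (line_tensor n d (pres.cls (scale (c t) ?s + ?R))) 1
      - Poly_Mapping.single (line_tensor n d (pres.cls (scale (c t) ?s))) 1 - Poly_Mapping.single (line_tensor n d (pres.cls ?R)) 1 \<in> ?J"
      using susp.tensor_rels_scaled(2)[OF line_gen_homog cls_homog cls_homog, of "scale (c t) ?s" ?R 1] t R(2)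
      by (simp add: line_tensor_def presented_operad_def)
    have "Poly_Mapping.keys (scale (c t) ?s + ?R) \<subseteq> tree_basis E n d"
      using Poly_Mapping.keys_add[of "scale (c t) ?s" ?R] R(2) t by (auto split: if_splits)
    then show ?case
      using insert(1,2) susp.had.I_diff[OF susp.had.I_diff[OF R(1) A] B] by (simp add: algebra_simps)
  qed
  then have LR: "?L - Poly_Mapping.single (line_tensor n d (pres.cls ?R)) 1 \<in> ?J" ..
  assume "?R \<in> I"
  then have "pres.cls ?R = smul Q 0 (pres.cls 0)"
    by (simp add: pres.cls_eq_zero_iff presented_operad_def)
  then have "Poly_Mapping.single (line_tensor n d (pres.cls ?R)) (1::'k) \<in> ?J"
    using susp.tensor_rels_scaled(4)[OF line_gen_homog cls_homog[of 0], of 0 1]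
    by (simp add: line_tensor_def)
  then show "?L \<in> ?J"
    using susp.had.I_add[OF LR] by fastforce
qed

lemma gen_homog:
  "b \<in> gset E \<Longrightarrow> gen E b \<in> homog (free_operad E) (gar E b) (gdeg E b)"
  by (simp add: gen_def free.homog tree_basis_def)

lemma gen_class_homog: "b \<in> gset E \<Longrightarrow> gen_class E R b \<in> homog Q (gar E b) (gdeg E b)"
  by (auto simp: gen_class_def presented_operad_def pres.quot_homog intro: gen_homog)

lemma gen_class_comp:
  assumes "b \<in> gset E" "c \<in> gset E" "1 \<le> i" "i \<le> gar E b"
  shows "pcomp Q (gen_class E R b) i (gen_class E R c)
    = pres.cls (Poly_Mapping.single (graft (corolla E b) i (corolla E c)) 1)"
proof -
  have "pcomp Q (gen_class E R b) i (gen_class E R c) = pres.cls (gen_comp E b i c)"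
    unfolding gen_class_def presented_operad_def gen_comp_def
    by (rule pres.quot_pcomp_homog[OF gen_homog gen_homog]) (rule assms)+
  then show ?thesis
    using assms by (simp add: gen_comp_eq)
qed

text \<open>Each tree evaluates to its own class tensored with the line generator, times the sign
  \<open>\<sigma> t\<close>. Homogeneity puts all these tensors in one arity and degree, and then
  \<open>sum_cls_tensor\<close> removes the line.\<close>

lemma eval_suspension_eq_zero_iff:
  assumes x: "Poly_Mapping.keys x \<subseteq> tree_basis E n d"
    and \<sigma>: "\<And>t. t \<in> Poly_Mapping.keys x \<Longrightarrow> \<exists>b i c. b \<in> gset E \<and> c \<in> gset E \<and> 1 \<le> i \<and> i \<le> gar E b \<and>
      t = graft (corolla E b) i (corolla E c) \<and>
      \<sigma> t = koszul (gdeg E b) (end_deg 1 (gar E c)) * end_sign 1 i (gar E c)"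
  shows "eval (suspension Q) (susp_gen Q E (gen_class E R)) x = zer (suspension Q)
    \<longleftrightarrow> (\<Sum>t\<in>Poly_Mapping.keys x. Poly_Mapping.single t (Poly_Mapping.lookup x t * \<sigma> t)) \<in> I"
proof -
  have "eval_tree (suspension Q) (susp_gen Q E (gen_class E R)) t
    = susp.had.cls (Poly_Mapping.single (line_tensor n d (pres.cls (Poly_Mapping.single t 1))) (\<sigma> t))"
    if tx: "t \<in> Poly_Mapping.keys x" for t
  proof -
    obtain b i c where t: "b \<in> gset E" "c \<in> gset E" "1 \<le> i" "i \<le> gar E b"
        "t = graft (corolla E b) i (corolla E c)"
        "\<sigma> t = koszul (gdeg E b) (end_deg 1 (gar E c)) * end_sign 1 i (gar E c)"
      using \<sigma>[OF tx] by blast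
    have "n = gar E b + gar E c - 1" "d = gdeg E b + gdeg E c"
      using x tx t(3,4) by (auto simp: t(5) tree_basis_def leaves_graft tdeg_graft)
    then show ?thesis
      using eval_tree_suspension[OF gen_class_homog t(1-4)] gen_class_comp[OF t(1-4)] t(5,6)
      by simp
  qed
  then have "eval (suspension Q) (susp_gen Q E (gen_class E R)) x = susp.had.cls
      (\<Sum>t\<in>Poly_Mapping.keys x. Poly_Mapping.single (line_tensor n d (pres.cls (Poly_Mapping.single t 1)))
        (Poly_Mapping.lookup x t * \<sigma> t))"
    using susp.had.fold_add[of "Poly_Mapping.keys x" _
        "\<lambda>t. Poly_Mapping.single (line_tensor n d (pres.cls (Poly_Mapping.single t 1))) (\<sigma> t)" "Poly_Mapping.lookup x"]
    unfolding eval_def suspension_quot by simp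
  then show ?thesis
    using sum_cls_tensor[OF finite_keys x] by (simp add: suspension_quot susp.had.cls_eq_zero_iff)
qed

end


section \<open>Trees with two vertices\<close>

text \<open>Written out without grafting corollas, so that the same trees serve all three
  collections of generators, which differ only in degrees.\<close>

definition two_tree :: "nat \<Rightarrow> nat \<Rightarrow> nat \<Rightarrow> nat ptree" where
  "two_tree m i k = Node m (replicate (i - 1) Leaf @ Node k (replicate k Leaf) # replicate (m - i) Leaf)"

definition two_trees :: "nat \<Rightarrow> nat ptree set" where
  "two_trees n = {two_tree m i k | m i k. 2 \<le> m \<and> 2 \<le> k \<and> 1 \<le> i \<and> i \<le> m \<and> m + k = n + 1}"

lemma two_treesE:
  assumes "t \<in> two_trees n"
  obtains m i k where "2 \<le> m" "2 \<le> k" "1 \<le> i" "i \<le> m" "m + k = n + 1" "t = two_tree m i k"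
  using assms unfolding two_trees_def by blast

lemma two_treesI:
  "2 \<le> m \<Longrightarrow> 2 \<le> k \<Longrightarrow> 1 \<le> i \<Longrightarrow> i \<le> m \<Longrightarrow> m + k = n + 1 \<Longrightarrow> two_tree m i k \<in> two_trees n"
  unfolding two_trees_def by blast

lemma graft_corolla_two_tree:
  "gar E = (\<lambda>k. k) \<Longrightarrow> 1 \<le> i \<Longrightarrow> i \<le> m \<Longrightarrow> graft (corolla E m) i (corolla E k) = two_tree m i k"
  by (simp add: graft_corolla two_tree_def) (simp add: corolla_def)

lemma two_tree_eq_iff:
  assumes "1 \<le> i" "i \<le> m" "1 \<le> i'" "i' \<le> m'"
  shows "two_tree m i k = two_tree m' i' k' \<longleftrightarrow> m = m' \<and> i = i' \<and> k = k'"
proof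
  \<comment> \<open>The number of leading leaves below the root recovers the grafting
    position.\<close>
  let ?l = "\<lambda>t. case t of Leaf \<Rightarrow> 0 | Node _ ts \<Rightarrow> length (takeWhile (\<lambda>u. u = Leaf) ts)"
  have l: "?l (two_tree m i k) = i - 1" for m i k :: nat
    by (simp add: two_tree_def takeWhile_append)
  assume eq: "two_tree m i k = two_tree m' i' k'"
  from this l[of m i k] l[of m' i' k'] have "i - 1 = i' - 1"
    by simp
  with assms eq show "m = m' \<and> i = i' \<and> k = k'"
    by (simp add: two_tree_def)
qed simp

lemma leaves_two_tree [simp]: "1 \<le> i \<Longrightarrow> i \<le> m \<Longrightarrow> leaves (two_tree m i k) = m + k - 1"
  by (simp add: two_tree_def sum_list_replicate)

lemma weight_two_tree [simp]: "weight (two_tree m i k) = 2"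
  by (simp add: two_tree_def sum_list_replicate)

lemma tdeg_two_tree [simp]: "tdeg E (two_tree m i k) = gdeg E m + gdeg E k"
  by (simp add: two_tree_def sum_list_replicate)

lemma wf_two_tree:
  "gset E = {2..} \<Longrightarrow> gar E = (\<lambda>k. k) \<Longrightarrow> 2 \<le> m \<Longrightarrow> 2 \<le> k \<Longrightarrow> 1 \<le> i \<Longrightarrow> i \<le> m \<Longrightarrow> wf_tree E (two_tree m i k)"
  by (auto simp: two_tree_def)

lemma weight_list_eq_0:
  "sum_list (map weight ts) = 0 \<Longrightarrow> ts = replicate (length ts) Leaf"
  by (induction ts) auto

lemma weight_list_eq_1:
  "sum_list (map weight ts) = 1 \<Longrightarrow> \<exists>a b u. ts = replicate a Leaf @ u # replicate b Leaf \<and> weight u = 1"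
proof (induction ts)
  case (Cons t ts)
  show ?case
  proof (cases "t = Leaf")
    case True
    with Cons obtain a b u where "ts = replicate a Leaf @ u # replicate b Leaf" "weight u = 1"
      by auto
    then have "t # ts = replicate (Suc a) Leaf @ u # replicate b Leaf \<and> weight u = 1"
      using True by simp
    then show ?thesis by blast
  next
    case False
    then have "0 < weight t" by simp
    moreover have "weight t + sum_list (map weight ts) = 1"
      using Cons.prems by simp
    ultimately have "weight t = 1" "sum_list (map weight ts) = 0"
      by linarith+
    then have "t # ts = replicate 0 Leaf @ t # replicate (length ts) Leaf \<and> weight t = 1"
      using weight_list_eq_0[of ts] by simp
    then show ?thesis by blast
  qed
qed simp

text \<open>The root takes one unit of weight, so exactly one child is not a leaf, and all children
  of that child are leaves.\<close>

lemma weight_2_two_tree: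
  assumes E: "gset E = {2..}" "gar E = (\<lambda>k. k)" and t: "wf_tree E t" "weight t = 2" "leaves t = n"
  shows "t \<in> two_trees n"
proof -
  obtain m ts where m: "t = Node m ts" "sum_list (map weight ts) = 1"
    using t(2) by (cases t) auto
  then obtain a b u where u: "ts = replicate a Leaf @ u # replicate b Leaf" "weight u = 1"
    using weight_list_eq_1 by blast
  obtain k us where k: "u = Node k us" "us = replicate (length us) Leaf"
    using u(2) weight_list_eq_0 by (cases u) auto
  have *: "2 \<le> m" "2 \<le> k" "length us = k" "m = a + Suc b"
    using t(1) E m(1) u(1) k(1) by auto
  then have "t = two_tree m (Suc a) k"
    using k m u unfolding two_tree_def by simp
  then show ?thesis
    using * t(3) by (auto intro!: two_treesI)
qed

text \<open>When the degree of a composite depends on \<open>m + k\<close> alone, the arity fixes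
  the degree in weight two; homogeneity then only asks for a single arity.\<close>

lemma quadratic_iff:
  assumes E: "gset E = {2..}" "gar E = (\<lambda>k. k)" and deg: "\<And>m k. gdeg E m + gdeg E k = \<delta> (m + k)"
  shows "x \<in> quadratic E \<longleftrightarrow> (\<exists>n. Poly_Mapping.keys x \<subseteq> two_trees n)"
    and "Poly_Mapping.keys x \<subseteq> two_trees n \<Longrightarrow> x \<in> homog (free_operad E) n (\<delta> (n + 1))"
proof -
  show 1: "x \<in> homog (free_operad E) n (\<delta> (n + 1))" if "Poly_Mapping.keys x \<subseteq> two_trees n" for n
    unfolding free.homog mem_Collect_eq
  proof
    fix t assume "t \<in> Poly_Mapping.keys x"
    with that have "t \<in> two_trees n" by blast
    then show "t \<in> tree_basis E n (\<delta> (n + 1))"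
      by (rule two_treesE) (use E in \<open>simp add: tree_basis_def wf_two_tree deg\<close>)
  qed
  show "x \<in> quadratic E \<longleftrightarrow> (\<exists>n. Poly_Mapping.keys x \<subseteq> two_trees n)"
  proof
    assume "x \<in> quadratic E"
    then obtain n d where x: "x \<in> homog (free_operad E) n d" "\<forall>t\<in>Poly_Mapping.keys x. weight t = 2"
      unfolding quadratic_def by blast
    then have "Poly_Mapping.keys x \<subseteq> two_trees n"
      using weight_2_two_tree[OF E] by (auto simp: free.homog tree_basis_def)
    then show "\<exists>n. Poly_Mapping.keys x \<subseteq> two_trees n" ..
  next
    assume "\<exists>n. Poly_Mapping.keys x \<subseteq> two_trees n"
    then obtain n where n: "Poly_Mapping.keys x \<subseteq> two_trees n" ..
    moreover have "\<forall>t\<in>Poly_Mapping.keys x. weight t = 2"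
      using n by (auto elim!: two_treesE)
    ultimately show "x \<in> quadratic E"
      using 1 unfolding quadratic_def by blast
  qed
qed

section \<open>The generators of ncGrav, of its suspension and of the Koszul dual\<close>

lemma ncGrav_gens_simps [simp]:
  "gset ncGrav_gens = {2..}" "gar ncGrav_gens = (\<lambda>k. k)" "gdeg ncGrav_gens = (\<lambda>k. 1)"
  by (simp_all add: ncGrav_gens_def)

lemma SncGrav_gens_simps [simp]:
  "gset SncGrav_gens = {2..}" "gar SncGrav_gens = (\<lambda>k. k)" "gdeg SncGrav_gens = (\<lambda>k. 2 - int k)"
  by (simp_all add: SncGrav_gens_def susp_collection_def end_deg_def fun_eq_iff)

lemma nu_gens_simps [simp]:
  "gset nu_gens = {2..}" "gar nu_gens = (\<lambda>k. k)" "gdeg nu_gens = (\<lambda>k. 2 * int k - 4)"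
  by (simp_all add: nu_gens_def)

text \<open>Origin of the degree of the generators: suspension gives
  \<open>(1 - k) + 1 = 2 - k\<close>, and dualizing gives
  \<open>- 1 + (k - 1) - (2 - k) = 2 * k - 4\<close>.\<close>

lemma dual_SncGrav_gens: "dual_collection SncGrav_gens = nu_gens"
  by (simp add: dual_collection_def SncGrav_gens_def susp_collection_def ncGrav_gens_def nu_gens_def
      end_deg_def fun_eq_iff)

lemmas quadratic_ncGrav = quadratic_iff[of ncGrav_gens "\<lambda>_. 2", simplified]
lemmas quadratic_SncGrav = quadratic_iff[of SncGrav_gens "\<lambda>p. 4 - int p", simplified]
lemmas quadratic_nu = quadratic_iff[of nu_gens "\<lambda>p. 2 * int p - 8", simplified]

lemma gen_comp_two_tree:
  "gar E = (\<lambda>k. k) \<Longrightarrow> 1 \<le> i \<Longrightarrow> i \<le> m \<Longrightarrow> gen_comp E m i k = Poly_Mapping.single (two_tree m i k) 1"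
  by (simp add: gen_comp_eq graft_corolla_two_tree)


section \<open>The relations of ncGrav and their suspensions\<close>

text \<open>The sign that the suspension gives to a composite of two generators, as a function of
  the tree; the choice is unambiguous because a tree determines \<open>m\<close>, \<open>i\<close>
  and \<open>k\<close>.\<close>

definition susp_sign :: "nat ptree \<Rightarrow> 'k::field" where
  "susp_sign t = (SOME s. \<exists>m i k. 1 \<le> i \<and> i \<le> m \<and> t = two_tree m i k \<and>
     s = koszul 1 (end_deg 1 k) * end_sign 1 i k)"

lemma susp_sign_two_tree:
  assumes "1 \<le> i" "i \<le> m"
  shows "susp_sign (two_tree m i k) = (koszul 1 (end_deg 1 k) * end_sign 1 i k :: 'k::field)"
  unfolding susp_sign_def
proof (rule some_equality)
  show "\<exists>m' i' k'. 1 \<le> i' \<and> i' \<le> m' \<and> two_tree m i k = two_tree m' i' k' \<and>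
      koszul 1 (end_deg 1 k) * end_sign 1 i k = (koszul 1 (end_deg 1 k') * end_sign 1 i' k' :: 'k)"
    using assms by blast
qed (use assms in \<open>auto simp: two_tree_eq_iff\<close>)

lemma susp_sign_square:
  assumes "t \<in> two_trees n"
  shows "susp_sign t * susp_sign t = (1 :: 'k::field)"
  using assms by (rule two_treesE) (simp add: susp_sign_two_tree end_sign_def koszul_def)

definition twist :: "(nat ptree \<Rightarrow>\<^sub>0 'k) \<Rightarrow> (nat ptree \<Rightarrow>\<^sub>0 'k::field)" where
  "twist x = (\<Sum>t\<in>Poly_Mapping.keys x. Poly_Mapping.single t (Poly_Mapping.lookup x t * susp_sign t))"

lemma lookup_twist: "Poly_Mapping.lookup (twist x) t = Poly_Mapping.lookup x t * susp_sign t"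
  by (simp add: twist_def lookup_sum lookup_single when_def in_keys_iff)

lemma keys_twist: "Poly_Mapping.keys (twist x) \<subseteq> Poly_Mapping.keys x"
  by (auto simp: in_keys_iff lookup_twist)

text \<open>As an involution, \<open>twist\<close> also leads back from relations of ncGrav to
  relations of the suspension.\<close>

lemma twist_twist:
  assumes "Poly_Mapping.keys x \<subseteq> two_trees n"
  shows "twist (twist x) = x"
proof (rule poly_mapping_eqI)
  fix t
  show "Poly_Mapping.lookup (twist (twist x)) t = Poly_Mapping.lookup x t"
  proof (cases "t \<in> Poly_Mapping.keys x")
    case True
    then show ?thesis
      using susp_sign_square[of t n] assms by (auto simp: lookup_twist mult.assoc)
  qed (simp add: lookup_twist in_keys_iff)
qed

definition grav_rel :: "nat \<Rightarrow> nat \<Rightarrow> nat \<Rightarrow> (nat ptree \<Rightarrow>\<^sub>0 'k::field)" where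
  "grav_rel n k r = (\<Sum>j=r..r+k-2. Poly_Mapping.single (two_tree (n - 1) j 2) 1)
     - Poly_Mapping.single (two_tree (n - k + 1) r k) 1"

definition grav_sum :: "nat \<Rightarrow> (nat ptree \<Rightarrow>\<^sub>0 'k::field)" where
  "grav_sum n = (\<Sum>j=1..n-1. Poly_Mapping.single (two_tree (n - 1) j 2) 1)"

lemma conj_cong_right: "(Q \<Longrightarrow> P = P') \<Longrightarrow> (P \<and> Q) = (P' \<and> Q)"
  by blast

lemma ncGrav_rels_eq:
  "ncGrav_rels = {grav_rel n k r | n k r. n \<ge> 4 \<and> 3 \<le> k \<and> k < n \<and> 1 \<le> r \<and> r \<le> n - k + 1}
     \<union> {grav_sum n | n. n \<ge> 3}"
proof -
  have rel: "(\<Sum>j=r..r+k-2. gen_comp ncGrav_gens (n - 1) j 2) - gen_comp ncGrav_gens (n - k + 1) r k = grav_rel n k r"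
    if "3 \<le> k" "k < n" "1 \<le> r" "r \<le> n - k + 1" for n k r
    unfolding grav_rel_def using that
    by (intro arg_cong2[of _ _ _ _ "(-)"] sum.cong) (auto simp: gen_comp_two_tree)
  have sum: "(\<Sum>j=1..n-1. gen_comp ncGrav_gens (n - 1) j 2) = grav_sum n" for n
    unfolding grav_sum_def by (simp add: gen_comp_two_tree)
  show ?thesis
    unfolding ncGrav_rels_def sum
    by (intro arg_cong2[of _ _ _ _ "(\<union>)"] Collect_cong ex_cong1 conj_cong_right refl; elim conjE; simp only: rel)
qed

lemma keys_sum_singles:
  assumes "\<And>j. j \<in> S \<Longrightarrow> g j \<in> A"
  shows "Poly_Mapping.keys (\<Sum>j\<in>S. Poly_Mapping.single (g j) c) \<subseteq> A"
  using keys_sum[of "\<lambda>j. Poly_Mapping.single (g j) c" S] assms by (fastforce split: if_splits)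

lemma keys_diff_subset:
  "Poly_Mapping.keys x \<subseteq> A \<Longrightarrow> Poly_Mapping.keys y \<subseteq> A \<Longrightarrow> Poly_Mapping.keys (x - y) \<subseteq> A"
  using Poly_Mapping.keys_diff[of x y] by blast

lemma keys_grav_rel:
  assumes "3 \<le> k" "k < n" "1 \<le> r" "r \<le> n - k + 1"
  shows "Poly_Mapping.keys (grav_rel n k r) \<subseteq> two_trees n"
  unfolding grav_rel_def
  by (intro keys_diff_subset keys_sum_singles) (use assms in \<open>auto intro!: two_treesI\<close>)

lemma keys_grav_sum: "n \<ge> 3 \<Longrightarrow> Poly_Mapping.keys (grav_sum n) \<subseteq> two_trees n"
  unfolding grav_sum_def by (intro keys_sum_singles) (auto intro!: two_treesI)

lemma keys_ncGrav_rels: "r \<in> ncGrav_rels \<Longrightarrow> \<exists>n. Poly_Mapping.keys r \<subseteq> two_trees n"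
  unfolding ncGrav_rels_eq using keys_grav_rel keys_grav_sum by blast

interpretation grav: presentation ncGrav_gens ncGrav_rels
proof
  show "\<exists>n d. r \<in> homog (free_operad ncGrav_gens) n d" if "r \<in> ncGrav_rels" for r :: "nat ptree \<Rightarrow>\<^sub>0 'a"
    using keys_ncGrav_rels[OF that] quadratic_ncGrav(2) by blast
qed

text \<open>Here the suspension leaves the argument: only the signs in \<open>twist\<close> and the
  ideal of ncGrav remain.\<close>

lemma SncGrav_rels_iff:
  "x \<in> SncGrav_rels \<longleftrightarrow> (\<exists>n. Poly_Mapping.keys x \<subseteq> two_trees n) \<and>
     twist x \<in> operad_ideal (free_operad ncGrav_gens) ncGrav_rels"
proof -
  have "eval (suspension ncGrav) (susp_gen ncGrav ncGrav_gens (gen_class ncGrav_gens ncGrav_rels)) x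
      = zer (suspension ncGrav) \<longleftrightarrow> twist x \<in> operad_ideal (free_operad ncGrav_gens) ncGrav_rels"
    if "Poly_Mapping.keys x \<subseteq> two_trees n" for n
    unfolding ncGrav_def twist_def
  proof (rule grav.eval_suspension_eq_zero_iff)
    show "Poly_Mapping.keys x \<subseteq> tree_basis ncGrav_gens n 2"
      using quadratic_ncGrav(2)[OF that] by (simp add: free.homog)
    fix t assume "t \<in> Poly_Mapping.keys x"
    with that have "t \<in> two_trees n" by blast
    then obtain m i k where t: "2 \<le> m" "2 \<le> k" "1 \<le> i" "i \<le> m" "t = two_tree m i k"
      by (rule two_treesE)
    then show "\<exists>b i c. b \<in> gset ncGrav_gens \<and> c \<in> gset ncGrav_gens \<and> 1 \<le> i \<and> i \<le> gar ncGrav_gens b \<and>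
      t = graft (corolla ncGrav_gens b) i (corolla ncGrav_gens c) \<and>
      susp_sign t = koszul (gdeg ncGrav_gens b) (end_deg 1 (gar ncGrav_gens c)) * end_sign 1 i (gar ncGrav_gens c)"
      by (intro exI[of _ m] exI[of _ i] exI[of _ k]) (simp add: graft_corolla_two_tree susp_sign_two_tree)
  qed
  then show ?thesis
    unfolding SncGrav_rels_def quadratic_rels_def mem_Collect_eq quadratic_SncGrav(1) by blast
qed


section \<open>The orthogonal complement\<close>

text \<open>Parities: the Hadamard sign and the sign of the pairing with \<open>sb\<close> and
  \<open>sc\<close> both have exponent \<open>(m - 1) * (k - 1)\<close> and cancel, leaving
  \<open>(i - 1) * (k - 1) + m\<close>. The suspension sign has exponent
  \<open>(k - 1) + (i - 1) * (k - 1)\<close>, and the two differ by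
  \<open>m + k - 1 = n\<close>.\<close>

lemma pairing_sign_eq:
  assumes "1 \<le> i" "m + k = n + 1"
  shows "pairing_sign SncGrav_gens m i k = koszul 1 (int n) * (koszul 1 (end_deg 1 k) * end_sign 1 i k :: 'k::field)"
proof -
  obtain j where "i = Suc j" using assms(1) by (cases i) auto
  moreover have "int n = int m + int k - 1" using assms(2) by simp
  ultimately show ?thesis
    by (cases "even m"; cases "even k"; cases "even j")
      (simp_all add: pairing_sign_def koszul_def end_sign_def end_deg_def)
qed

text \<open>A tree determines its triple, so the sum over triples becomes a sum over trees. The
  factor in front is a unit depending only on the arity and does not affect orthogonality.\<close>

lemma pairing_eq:
  fixes y :: "nat ptree \<Rightarrow>\<^sub>0 'k::field"
  assumes x: "Poly_Mapping.keys x \<subseteq> two_trees n"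
  shows "pairing SncGrav_gens y x = koszul 1 (int n) * dot y (twist x)"
proof -
  let ?S = "{(b, i, c). 2 \<le> b \<and> 2 \<le> c \<and> 1 \<le> i \<and> i \<le> b \<and> two_tree b i c \<in> Poly_Mapping.keys x}"
  let ?f = "\<lambda>(b, i, c). two_tree b i c"
  have n: "b + c = n + 1" if "(b, i, c) \<in> ?S" for b i c
  proof -
    have "two_tree b i c \<in> two_trees n" using that x by blast
    then show ?thesis
      by (rule two_treesE) (use that in \<open>auto simp: two_tree_eq_iff\<close>)
  qed
  have "bij_betw ?f ?S (Poly_Mapping.keys x)"
  proof (rule bij_betw_imageI)
    show "inj_on ?f ?S"
      by (auto simp: inj_on_def two_tree_eq_iff)
    show "?f ` ?S = Poly_Mapping.keys x"
    proof
      show "Poly_Mapping.keys x \<subseteq> ?f ` ?S"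
      proof
        fix t assume t: "t \<in> Poly_Mapping.keys x"
        with x have "t \<in> two_trees n" by blast
        then show "t \<in> ?f ` ?S"
          by (rule two_treesE) (use t in \<open>force simp: image_iff\<close>)
      qed
    qed auto
  qed
  then have "(\<Sum>t\<in>Poly_Mapping.keys x. koszul 1 (int n) * (Poly_Mapping.lookup y t * (Poly_Mapping.lookup x t * susp_sign t)))
    = (\<Sum>p\<in>?S. koszul 1 (int n) * (Poly_Mapping.lookup y (?f p) * (Poly_Mapping.lookup x (?f p) * susp_sign (?f p))))"
    by (rule sum.reindex_bij_betw[symmetric])
  also have "\<dots> = (\<Sum>(b, i, c)\<in>?S. pairing_sign SncGrav_gens b i c * Poly_Mapping.lookup y (two_tree b i c)
       * Poly_Mapping.lookup x (two_tree b i c))"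
  proof (rule sum.cong[OF refl])
    fix p assume p: "p \<in> ?S"
    obtain b i c where "p = (b, i, c)" by (cases p)
    with p n[of b i c] show "koszul 1 (int n) * (Poly_Mapping.lookup y (?f p) * (Poly_Mapping.lookup x (?f p) * susp_sign (?f p)))
      = (case p of (b, i, c) \<Rightarrow> pairing_sign SncGrav_gens b i c * Poly_Mapping.lookup y (two_tree b i c)
       * Poly_Mapping.lookup x (two_tree b i c))"
      by (simp add: pairing_sign_eq[of i b c n] susp_sign_two_tree)
  qed
  also have "\<dots> = pairing SncGrav_gens y x"
    unfolding pairing_def
    by (rule sum.cong) (auto simp: graft_corolla_two_tree)
  finally show ?thesis
    by (simp add: dot_superset[OF finite_keys keys_twist] lookup_twist sum_distrib_left)
qed

section \<open>The relations of ncHyperCom as functionals on those of ncGrav\<close>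

definition hyper_rel :: "nat \<Rightarrow> nat \<Rightarrow> (nat ptree \<Rightarrow>\<^sub>0 'k::field)" where
  "hyper_rel n i = (\<Sum>j=2..i. Poly_Mapping.single (two_tree (n - j + 1) (i - j + 1) j) 1)
     - (\<Sum>k=2..n-i+1. Poly_Mapping.single (two_tree (n - k + 1) i k) 1)"

definition hyper_rels :: "(nat ptree \<Rightarrow>\<^sub>0 'k::field) set" where
  "hyper_rels = {hyper_rel n i | n i. n \<ge> 3 \<and> 2 \<le> i \<and> i \<le> n - 1}"

lemma hyper_rels_eq:
  "{(\<Sum>j=2..i. gen_comp nu_gens (n - j + 1) (i - j + 1) j) - (\<Sum>k=2..n-i+1. gen_comp nu_gens (n - k + 1) i k)
     | n i. n \<ge> 3 \<and> 2 \<le> i \<and> i \<le> n - 1} = hyper_rels"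
proof -
  have rel: "(\<Sum>j=2..i. gen_comp nu_gens (n - j + 1) (i - j + 1) j) - (\<Sum>k=2..n-i+1. gen_comp nu_gens (n - k + 1) i k)
    = hyper_rel n i" if "2 \<le> i" "i \<le> n - 1" for n i
    unfolding hyper_rel_def using that
    by (intro arg_cong2[of _ _ _ _ "(-)"] sum.cong) (auto simp: gen_comp_two_tree)
  show ?thesis
    unfolding hyper_rels_def
    by (intro Collect_cong ex_cong1 conj_cong_right; elim conjE; simp only: rel)
qed

lemma keys_hyper_rel:
  assumes "2 \<le> i" "i \<le> n - 1"
  shows "Poly_Mapping.keys (hyper_rel n i) \<subseteq> two_trees n"
  unfolding hyper_rel_def
  by (intro keys_diff_subset keys_sum_singles) (use assms in \<open>auto intro!: two_treesI\<close>)

lemma lookup_hyper_rel: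
  assumes "2 \<le> i" "i \<le> n - 1" "1 \<le> r" "r \<le> m" "2 \<le> m" "2 \<le> k"
  shows "Poly_Mapping.lookup (hyper_rel n i) (two_tree m r k) =
    (if m + k = n + 1 then of_bool (r + k - 1 = i) - of_bool (r = i) else 0 :: 'k::field)"
proof -
  have "(\<Sum>j=2..i. Poly_Mapping.lookup (Poly_Mapping.single (two_tree (n - j + 1) (i - j + 1) j) 1) (two_tree m r k))
    = (\<Sum>j=2..i. if j = k then of_bool (m + k = n + 1 \<and> r + k - 1 = i) else (0 :: 'k))"
    by (rule sum.cong) (use assms in \<open>auto simp: lookup_single when_def two_tree_eq_iff\<close>)
  \<comment> \<open>The term \<open>j = k\<close> is in range: \<open>r + k - 1 = i\<close> and
    \<open>1 \<le> r\<close> give \<open>k \<le> i\<close>. In the second sum \<open>r = i\<close>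
    and \<open>r \<le> m\<close> give \<open>k \<le> n - i + 1\<close>.\<close>
  also have "\<dots> = of_bool (m + k = n + 1 \<and> r + k - 1 = i)"
    using assms by auto
  finally have 1: "(\<Sum>j=2..i. Poly_Mapping.lookup (Poly_Mapping.single (two_tree (n - j + 1) (i - j + 1) j) 1) (two_tree m r k))
    = (of_bool (m + k = n + 1 \<and> r + k - 1 = i) :: 'k)" .
  have "(\<Sum>j=2..n-i+1. Poly_Mapping.lookup (Poly_Mapping.single (two_tree (n - j + 1) i j) 1) (two_tree m r k))
    = (\<Sum>j=2..n-i+1. if j = k then of_bool (m + k = n + 1 \<and> r = i) else (0 :: 'k))"
    by (rule sum.cong) (use assms in \<open>auto simp: lookup_single when_def two_tree_eq_iff\<close>)
  also have "\<dots> = of_bool (m + k = n + 1 \<and> r = i)"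
    using assms by auto
  finally have 2: "(\<Sum>j=2..n-i+1. Poly_Mapping.lookup (Poly_Mapping.single (two_tree (n - j + 1) i j) 1) (two_tree m r k))
    = (of_bool (m + k = n + 1 \<and> r = i) :: 'k)" .
  show ?thesis
    unfolding hyper_rel_def lookup_minus lookup_sum 1 2 by simp
qed

lemma dot_grav_rel:
  "dot y (grav_rel n k r) = (\<Sum>j=r..r+k-2. Poly_Mapping.lookup y (two_tree (n - 1) j 2))
     - Poly_Mapping.lookup y (two_tree (n - k + 1) r k)"
  by (simp add: grav_rel_def dot_sum)

lemma dot_grav_sum: "dot y (grav_sum n) = (\<Sum>j=1..n-1. Poly_Mapping.lookup y (two_tree (n - 1) j 2))"
  by (simp add: grav_sum_def dot_sum)

lemma dot_hyper_rel_ncGrav_rels: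
  assumes "2 \<le> i" "i \<le> n - 1" "r \<in> ncGrav_rels"
  shows "dot (hyper_rel n i) r = (0 :: 'k::field)"
  using assms(3) unfolding ncGrav_rels_eq
proof (elim UnE CollectE exE conjE)
  fix p k s assume *: "r = grav_rel p k s" "4 \<le> p" "3 \<le> k" "k < p" "1 \<le> s" "s \<le> p - k + 1"
  have "dot (hyper_rel n i) r = (\<Sum>j=s..s+k-2. if p = n then of_bool (Suc j = i) - of_bool (j = i) else 0)
      - (if p = n then of_bool (s + k - 1 = i) - of_bool (s = i) else 0 :: 'k)"
    unfolding *(1) dot_grav_rel
    by (intro arg_cong2[of _ _ _ _ "(-)"] sum.cong) (use * assms in \<open>auto simp: lookup_hyper_rel\<close>)
  also have "\<dots> = 0"
  proof (cases "p = n")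
    case True
    \<comment> \<open>Telescoping: the coefficients at the trees with \<open>k = 2\<close> are
      successive differences of the indicator of \<open>i\<close>.\<close>
    have "(\<Sum>j=s..s+k-2. of_bool (Suc j = i) - of_bool (j = i)) = (of_bool (Suc (s + k - 2) = i) - of_bool (s = i) :: 'k)"
      by (rule sum_Suc_diff) (use * in simp)
    also have "Suc (s + k - 2) = s + k - 1"
      using * by simp
    finally show ?thesis
      by (simp only: True refl if_True diff_self)
  qed simp
  finally show ?thesis .
next
  fix p assume *: "r = grav_sum p" "3 \<le> p"
  have "dot (hyper_rel n i) r = (\<Sum>j=1..p-1. if p = n then of_bool (Suc j = i) - of_bool (j = i) else 0 :: 'k)"
    unfolding *(1) dot_grav_sum
    by (intro sum.cong) (use * assms in \<open>auto simp: lookup_hyper_rel\<close>)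
  also have "\<dots> = 0"
  proof (cases "p = n")
    case True
    \<comment> \<open>The surviving end terms ask for \<open>i = n\<close> or \<open>i = 1\<close>,
      both excluded by the range of \<open>i\<close>.\<close>
    have "(\<Sum>j=1..p-1. of_bool (Suc j = i) - of_bool (j = i)) = (of_bool (Suc (p - 1) = i) - of_bool (1 = i) :: 'k)"
      by (rule sum_Suc_diff) simp
    also have "\<dots> = 0"
      using True * assms by simp
    finally show ?thesis
      using True by simp
  qed simp
  finally show ?thesis .
qed

text \<open>A relation of the suspension is known only to have its twist in the ideal, not in the
  span of the given relations; \<open>dot_ideal\<close> bridges this gap.\<close>

lemma hyper_rels_orthogonal:
  "hyper_rels \<subseteq> orthogonal SncGrav_gens (SncGrav_rels :: (nat ptree \<Rightarrow>\<^sub>0 'k::field) set)"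
proof
  fix y :: "nat ptree \<Rightarrow>\<^sub>0 'k" assume "y \<in> hyper_rels"
  then obtain n i where y: "y = hyper_rel n i" "2 \<le> i" "i \<le> n - 1"
    unfolding hyper_rels_def by blast
  have "y \<in> quadratic (dual_collection SncGrav_gens)"
    unfolding dual_SncGrav_gens quadratic_nu(1) using keys_hyper_rel y by blast
  moreover have "pairing SncGrav_gens y x = 0" if "x \<in> SncGrav_rels" for x
  proof -
    from that obtain p where p: "Poly_Mapping.keys x \<subseteq> two_trees p"
        "twist x \<in> operad_ideal (free_operad ncGrav_gens) ncGrav_rels"
      unfolding SncGrav_rels_iff by blast
    have "dot y (twist x) = 0"
    proof (rule dot_ideal[OF _ _ _ p(2)])
      show "weight_ge_2 r" if "r \<in> ncGrav_rels" for r :: "nat ptree \<Rightarrow>\<^sub>0 'k"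
        using keys_ncGrav_rels[OF that] unfolding weight_ge_2_def by (fastforce elim: two_treesE)
      show "dot y r = 0" if "r \<in> ncGrav_rels" for r
        unfolding y using dot_hyper_rel_ncGrav_rels[OF y(2,3) that] .
      show "weight t = 2" if "t \<in> Poly_Mapping.keys y" for t
        using that keys_hyper_rel[OF y(2,3)] unfolding y by (fastforce elim: two_treesE)
    qed
    then show ?thesis
      by (simp add: pairing_eq[OF p(1)])
  qed
  ultimately show "y \<in> orthogonal SncGrav_gens SncGrav_rels"
    unfolding orthogonal_def by blast
qed

text \<open>The twist of a relation \<open>r\<close> of ncGrav is a relation of the suspension, and
  pairing with it undoes the twist.\<close>

lemma orthogonal_dot:
  fixes y :: "nat ptree \<Rightarrow>\<^sub>0 'k::field"
  assumes "y \<in> orthogonal SncGrav_gens SncGrav_rels" "r \<in> ncGrav_rels"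
  shows "dot y r = 0"
proof -
  obtain n where n: "Poly_Mapping.keys r \<subseteq> two_trees n"
    using keys_ncGrav_rels assms(2) by blast
  then have tn: "Poly_Mapping.keys (twist r) \<subseteq> two_trees n"
    using keys_twist by blast
  have "twist r \<in> SncGrav_rels"
    unfolding SncGrav_rels_iff twist_twist[OF n] using tn operad_ideal.rel[OF assms(2)] by blast
  then have "koszul 1 (int n) * dot y r = 0"
    using assms(1) pairing_eq[OF tn, of y] twist_twist[OF n] by (simp add: orthogonal_def)
  then show ?thesis
    by (auto simp: koszul_def split: if_splits)
qed

text \<open>An orthogonal element is determined by its coefficients at the trees \<open>two_tree (n - 1) j 2\<close>, whose
  total is zero; their partial sums are the coefficients with respect to the \<open>hyper_rel n i\<close>.\<close>

lemma orthogonal_hyper_rels: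
  fixes y :: "nat ptree \<Rightarrow>\<^sub>0 'k::field"
  assumes y: "y \<in> orthogonal SncGrav_gens SncGrav_rels"
  shows "y \<in> operad_ideal (free_operad nu_gens) hyper_rels"
proof -
  have "y \<in> quadratic nu_gens"
    using y by (simp add: orthogonal_def dual_SncGrav_gens)
  then obtain n where n: "Poly_Mapping.keys y \<subseteq> two_trees n"
    unfolding quadratic_nu(1) by blast
  \<comment> \<open>The upper bound is exclusive, so \<open>s 1\<close> is the empty sum and
    \<open>s n\<close> the total that \<open>grav_sum n\<close> forces to vanish.\<close>
  define s where "s i = (\<Sum>j=1..<i. Poly_Mapping.lookup y (two_tree (n - 1) j 2))" for i
  have s1: "s 1 = 0"
    by (simp add: s_def)
  have sn: "s n = 0" if "3 \<le> n"
  proof -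
    have "dot y (grav_sum n) = 0"
      using orthogonal_dot[OF y] that unfolding ncGrav_rels_eq by blast
    moreover have "{1..n-1} = {1..<n}"
      using that by auto
    ultimately show ?thesis
      by (simp add: dot_grav_sum s_def)
  qed
  have coeff: "Poly_Mapping.lookup y (two_tree m r k) = s (r + k - 1) - s r"
    if mk: "2 \<le> m" "2 \<le> k" "1 \<le> r" "r \<le> m" "m + k = n + 1" for m r k
  proof -
    have m: "m = n - k + 1" "k < n"
      using mk by auto
    have "Poly_Mapping.lookup y (two_tree m r k) = (\<Sum>j=r..r+k-2. Poly_Mapping.lookup y (two_tree (n - 1) j 2))"
    \<comment> \<open>The relations \<open>grav_rel\<close> start at \<open>k = 3\<close>; for
      \<open>k = 2\<close> the sum has a single term.\<close>
    proof (cases "k = 2")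
      case True
      then have "m = n - 1" using mk by simp
      then show ?thesis using True by simp
    next
      case False
      then have "grav_rel n k r \<in> ncGrav_rels"
        using mk m unfolding ncGrav_rels_eq by fastforce
      from orthogonal_dot[OF y this] show ?thesis
        by (simp add: dot_grav_rel m)
    qed
    also have "{r..r+k-2} = {r..<r+k-1}"
      using mk by auto
    also have "(\<Sum>j=r..<r+k-1. Poly_Mapping.lookup y (two_tree (n - 1) j 2)) = s (r + k - 1) - s r"
      using sum.atLeastLessThan_concat[of 1 r "r + k - 1" "\<lambda>j. Poly_Mapping.lookup y (two_tree (n - 1) j 2)"] mk
      by (simp add: s_def algebra_simps)
    finally show ?thesis .
  qed
  have "y = (\<Sum>i=2..n-1. scale (s i) (hyper_rel n i))"
  proof (rule poly_mapping_eqI)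
    fix t
    show "Poly_Mapping.lookup y t = Poly_Mapping.lookup (\<Sum>i=2..n-1. scale (s i) (hyper_rel n i)) t"
    proof (cases "t \<in> two_trees n")
      case True
      then obtain m r k where t: "2 \<le> m" "2 \<le> k" "1 \<le> r" "r \<le> m" "m + k = n + 1" "t = two_tree m r k"
        by (rule two_treesE)
      have "(\<Sum>i=2..n-1. s i * Poly_Mapping.lookup (hyper_rel n i) t)
        = (\<Sum>i=2..n-1. (if r + k - 1 = i then s i else 0) - (if r = i then s i else 0))"
        by (rule sum.cong) (use t in \<open>auto simp: lookup_hyper_rel\<close>)
      also have "\<dots> = s (r + k - 1) - s r"
      proof -
        have "(\<Sum>i=2..n-1. (if u = i then s i else 0) - (if v = i then s i else 0)) = s u - s v"
          if "u \<notin> {2..n-1} \<longrightarrow> s u = 0" "v \<notin> {2..n-1} \<longrightarrow> s v = 0" for u v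
          using that by (simp add: sum_subtractf)
        \<comment> \<open>The end positions \<open>r = 1\<close> and \<open>r + k - 1 = n\<close>
          have no relation of their own; there \<open>s\<close> vanishes, so the formula
          persists.\<close>
        moreover have "r + k - 1 \<in> {2..n-1} \<or> r + k - 1 = n"
          using t by auto
        then have "r + k - 1 \<notin> {2..n-1} \<longrightarrow> s (r + k - 1) = 0"
          using sn t by auto
        moreover have "r \<in> {2..n-1} \<or> r = 1"
          using t by auto
        then have "r \<notin> {2..n-1} \<longrightarrow> s r = 0"
          using s1 by auto
        ultimately show ?thesis .
      qed
      finally show ?thesis
        using coeff[OF t(1-5)] t(6) by (simp add: lookup_sum)
    next
      case False
      then have "t \<notin> Poly_Mapping.keys y" "\<And>i. i \<in> {2..n-1} \<Longrightarrow> t \<notin> Poly_Mapping.keys (hyper_rel n i :: nat ptree \<Rightarrow>\<^sub>0 'k)"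
        using n keys_hyper_rel by (fastforce, fastforce)
      then show ?thesis
        by (simp add: lookup_sum in_keys_iff)
    qed
  qed
  moreover have "(\<Sum>i\<in>S. scale (s i) (hyper_rel n i)) \<in> operad_ideal (free_operad nu_gens) hyper_rels"
    if "S \<subseteq> {2..n-1}" for S
    using finite_subset[OF that finite_atLeastAtMost] that
  proof (induction S rule: finite_induct)
    case empty
    show ?case using operad_ideal.zero[of "free_operad nu_gens"] by simp
  next
    case (insert i S)
    then have "hyper_rel n i \<in> hyper_rels"
      unfolding hyper_rels_def by force
    then have "smul (free_operad nu_gens) (s i) (hyper_rel n i) \<in> operad_ideal (free_operad nu_gens) hyper_rels"
      by (intro operad_ideal.smul operad_ideal.rel)
    from operad_ideal.add[OF this insert.IH] insert show ?case
      by simp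
  qed
  ultimately show ?thesis
    by simp
qed

text \<open>The two sets of relations generate the same ideal, so the presented operads are equal
  and not merely isomorphic.\<close>

lemma ncHyperCom_eq:
  "ncHyperCom = presented_operad nu_gens (hyper_rels :: (nat ptree \<Rightarrow>\<^sub>0 'k::field) set)"
proof -
  have "operad_ideal (free_operad nu_gens) (orthogonal SncGrav_gens SncGrav_rels)
      = operad_ideal (free_operad nu_gens) (hyper_rels :: (nat ptree \<Rightarrow>\<^sub>0 'k::field) set)"
    using orthogonal_hyper_rels hyper_rels_orthogonal
    by (intro equalityI operad_ideal_mono) (auto intro: operad_ideal.rel)
  then show ?thesis
    by (simp add: ncHyperCom_def koszul_dual_def dual_SncGrav_gens presented_operad_def)
qed

interpretation hyper: presentation nu_gens hyper_rels
proof
  fix r :: "nat ptree \<Rightarrow>\<^sub>0 'a" assume "r \<in> hyper_rels"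
  then obtain n i where "r = hyper_rel n i" "2 \<le> i" "i \<le> n - 1"
    unfolding hyper_rels_def by blast
  then show "\<exists>n d. r \<in> homog (free_operad nu_gens) n d"
    using quadratic_nu(2)[OF keys_hyper_rel] by blast
qed

theorem proposition4p4p1:
  "\<exists>\<nu> :: nat \<Rightarrow> (nat ptree \<Rightarrow>\<^sub>0 'k::field) set.
     (\<forall>k\<ge>2. \<nu> k \<in> homog (ncHyperCom :: ('k, (nat ptree \<Rightarrow>\<^sub>0 'k) set) operad) k (2 * int k - 4)) \<and>
     is_presentation (ncHyperCom :: ('k, (nat ptree \<Rightarrow>\<^sub>0 'k) set) operad) nu_gens \<nu>
       {(\<Sum>j=2..i. gen_comp nu_gens (n - j + 1) (i - j + 1) j)
          - (\<Sum>k=2..n-i+1. gen_comp nu_gens (n - k + 1) i k)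
        | n i. n \<ge> 3 \<and> 2 \<le> i \<and> i \<le> n - 1}"
proof (intro exI conjI allI impI)
  let ?\<nu> = "gen_class nu_gens (hyper_rels :: (nat ptree \<Rightarrow>\<^sub>0 'k) set)"
  show "?\<nu> k \<in> homog ncHyperCom k (2 * int k - 4)" if "2 \<le> k" for k
    using hyper.gen_class_homog[of k] that by (simp add: ncHyperCom_eq)
  \<comment> \<open>Since \<open>ncHyperCom_eq\<close> is an equality, the identity is the required
    isomorphism and the generators are the classes of the corollas.\<close>
  have "operad_iso id P P" for P :: "('k, (nat ptree \<Rightarrow>\<^sub>0 'k) set) operad"
    by (simp add: operad_iso_def)
  then show "is_presentation ncHyperCom nu_gens ?\<nu>
       {(\<Sum>j=2..i. gen_comp nu_gens (n - j + 1) (i - j + 1) j)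
          - (\<Sum>k=2..n-i+1. gen_comp nu_gens (n - k + 1) i k)
        | n i. n \<ge> 3 \<and> 2 \<le> i \<and> i \<le> n - 1}"
    unfolding hyper_rels_eq is_presentation_def ncHyperCom_eq
    using hyper.ns_operad_Q hyper.gen_class_homog by (intro conjI ballI exI[of _ id]) simp_all
qed

end
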